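(* Let $\mathcal{C}=(\mathcal{C},\mathbb{E},\mathfrak{s},\mathbb{E}^{-1})$ be an extriangulated category with a negative first extension. The assignments $$\Psi:(\mathcal{X},\mathcal{Y})\longmapsto \xi_{\mathcal{X}}=\xi^{\mathcal{Y}}\qquad\text{and}\qquad \Phi:\xi\longmapsto(\mathcal{P}(\xi),\mathcal{I}(\xi))$$ give mutually inverse bijections between the following classes: (1) balanced pairs $(\mathcal{X},\mathcal{Y})$ in $\mathcal{C}$; (2) proper classes $\xi$ of $\mathbb{E}$-triangles in $\mathcal{C}$ such that $\mathcal{C}$ has enough $\xi$-projectives and enough $\xi$-injectives.
   Context: **Extriangulated category** (Nakaoka–Palu): a triple $(\mathcal{C},\mathbb{E},\mathfrak{s})$ where $\mathcal{C}$ is an additive category, $\mathbb{E}:\mathcal{C}^{\rm op}\times\mathcal{C}\to{\rm Ab}$ is an additive bifunctor, and $\mathfrak{s}$ assigns to each $\delta\in\mathbb{E}(C,A)$ an equivalence class $\mathfrak{s}(\delta)=[A\xrightarrow{x}B\xrightarrow{y}C]$ of sequences (two such sequences are equivalent if there is an isomorphism of middle terms commuting with the maps, with identities on $A$ and $C$). For $a:A\to A'$, $c:C'\to C$ write $a_*\delta=\mathbb{E}(C,a)(\delta)$, $c^*\delta=\mathbb{E}(c,A)(\delta)$. A morphism from $\delta\in\mathbb{E}(C,A)$ to $\delta'\in\mathbb{E}(C',A')$ is a pair $(a:A\to A',c:C\to C')$ with $a_*\delta=c^*\delta'$. Axioms: every morphism $(a,c):\delta\to\delta'$ extends to a commutative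 triple $(a,b,c)$ between realizing sequences; $\mathfrak{s}(0)=[A\to A\oplus C\to C]$ and $\mathfrak{s}(\delta\oplus\delta')=\mathfrak{s}(\delta)\oplus\mathfrak{s}(\delta')$; (ET3) if $\mathfrak{s}(\delta)=[A\xrightarrow{x}B\xrightarrow{y}C]$, $\mathfrak{s}(\delta')=[A'\xrightarrow{x'}B'\xrightarrow{y'}C']$ and $bx=x'a$, there is $c$ with $cy=y'b$ and $a_*\delta=c^*\delta'$; (ET4) if $\delta\in\mathbb{E}(D,A)$, $\delta'\in\mathbb{E}(F,B)$ are realized by $A\xrightarrow{f}B\xrightarrow{f'}D$ and $B\xrightarrow{g}C\xrightarrow{g'}F$, there are an object $E$, $\delta''\in\mathbb{E}(E,A)$ realized by $A\xrightarrow{gf}C\xrightarrow{h'}E$, and maps $D\xrightarrow{d}E\xrightarrow{e}F$ realizing $f'_*\delta'$, with $h'g=df'$, $eh'=g'$, $d^*\delta''=\delta$, $f_*\delta''=e^*\delta'$; and the duals of (ET3), (ET4). If $\mathfrak{s}(\delta)=[A\xrightarrow{x}B\xrightarrow{y}C]$, then $A\xrightarrow{x}B\xrightarrow{y}C\overset{\delta}{\dashrightarrow}$ is called an $\mathbb{E}$-triangle; it is split if $\delta=0$. **Negative first extension** on $\mathcal{C}$: an additive bifunctor $\mathbb{E}^{-1}:\mathcal{C}^{\rm op}\times\mathcal{C}\to{\rm Ab}$ together with, for each $\delta\in\mathbb{E}(C,A)$, natural transformations $\delta^{-1}_\sharp:\mathbb{E}^{-1}(-,C)\to\mathcal{C}(-,A)$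 and $\delta^\sharp_{-1}:\mathbb{E}^{-1}(A,-)\to\mathcal{C}(C,-)$ such that for each $\mathbb{E}$-triangle $A\xrightarrow{f}B\xrightarrow{g}C\overset{\delta}{\dashrightarrow}$ the sequences $\mathbb{E}^{-1}(C,-)\to\mathbb{E}^{-1}(B,-)\to\mathbb{E}^{-1}(A,-)\xrightarrow{\delta^\sharp_{-1}}\mathcal{C}(C,-)\to\mathcal{C}(B,-)$ and $\mathbb{E}^{-1}(-,A)\to\mathbb{E}^{-1}(-,B)\to\mathbb{E}^{-1}(-,C)\xrightarrow{\delta^{-1}_\sharp}\mathcal{C}(-,A)\to\mathcal{C}(-,B)$ (unnamed maps induced by $f,g$) are exact. **Proper class**: a class $\xi$ of $\mathbb{E}$-triangles, closed under isomorphisms, such that (1) $\xi$ is closed under finite coproducts and contains all split $\mathbb{E}$-triangles; (2) $\xi$ is closed under base change (if $A\to B\to C\overset{\delta}{\dashrightarrow}$ is in $\xi$ and $c:C'\to C$, every $\mathbb{E}$-triangle $A\to B'\to C'\overset{c^*\delta}{\dashrightarrow}$ is in $\xi$) and under cobase change (for $a:A\to A'$, every $\mathbb{E}$-triangle $A'\to B'\to C\overset{a_*\delta}{\dashrightarrow}$ is in $\xi$); (3) $\xi$ is saturated: given $\mathbb{E}$-triangles $A_1\to B_1\to C\overset{\delta_1}{\dashrightarrow}$ and $A_2\to B_2\xrightarrow{y_2}C\overset{\delta_2}{\dashrightarrow}$, if the second one and $A_1\to M\to B_2\overset{y_2^*\delta_1}{\dashrightarrow}$ are in $\xi$, then so is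 the first. **$\xi$-projectives/injectives**: $P$ is $\xi$-projective if for every $A\to B\to C\dashrightarrow$ in $\xi$ the sequence $0\to\mathcal{C}(P,A)\to\mathcal{C}(P,B)\to\mathcal{C}(P,C)\to0$ is exact; dually, $I$ is $\xi$-injective if $0\to\mathcal{C}(C,I)\to\mathcal{C}(B,I)\to\mathcal{C}(A,I)\to0$ is always exact. $\mathcal{P}(\xi)$, $\mathcal{I}(\xi)$ are the full subcategories of $\xi$-projective, $\xi$-injective objects. $\mathcal{C}$ has enough $\xi$-projectives (resp. $\xi$-injectives) if for each object $A$ there is an $\mathbb{E}$-triangle $K\to P\to A\dashrightarrow$ (resp. $A\to I\to K\dashrightarrow$) in $\xi$ with $P\in\mathcal{P}(\xi)$ (resp. $I\in\mathcal{I}(\xi)$). **$\xi_{\mathcal{X}}$ and $\xi^{\mathcal{Y}}$**: for a full additive subcategory $\mathcal{X}$, an $\mathbb{E}$-triangle $A\to B\to C\dashrightarrow$ is $\mathcal{C}(\mathcal{X},-)$-exact if $0\to\mathcal{C}(X,A)\to\mathcal{C}(X,B)\to\mathcal{C}(X,C)\to0$ is exact for all $X\in\mathcal{X}$; $\xi_{\mathcal{X}}$ is the class of all such $\mathbb{E}$-triangles. For a full additive subcategory $\mathcal{Y}$, it is $\mathcal{C}(-,\mathcal{Y})$-exact if $0\to\mathcal{C}(C,Y)\to\mathcal{C}(B,Y)\to\mathcal{C}(A,Y)\to0$ is exact for all $Y\in\mathcal{Y}$; $\xi^{\mathcal{Y}}$ is the class of all such $\mathbb{E}$-triangles. **Balanced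 pair**: a pair $(\mathcal{X},\mathcal{Y})$ of full additive subcategories of $\mathcal{C}$ closed under direct summands such that $\xi_{\mathcal{X}}=\xi^{\mathcal{Y}}$, $\mathcal{X}=\mathcal{P}(\xi_{\mathcal{X}})$, $\mathcal{Y}=\mathcal{I}(\xi^{\mathcal{Y}})$, and $\mathcal{C}$ has enough $\xi_{\mathcal{X}}$-projectives and enough $\xi^{\mathcal{Y}}$-injectives. (The paper defines balanced pairs by this condition or by an equivalent one in terms of resolutions.) *)

theory Defs
  imports "HOL-Algebra.Exact_Sequence"
begin

section \<open>Additive categories\<close>

text \<open>
  Abelian groups are the commutative groups of HOL-Algebra, so the sum is written \<open>\<otimes>\<close> and the
  zero element \<open>\<one>\<close>.

  The objects are the elements of the type \<open>'o\<close>, and the morphisms \<open>A \<rightarrow> B\<close> are the elements of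
  \<open>carrier (Hom \<C> A B)\<close>.  Hom-groups are not required to be disjoint.  Composition (and below the
  action on extensions) does not take the objects as arguments; this loses no generality, as one
  can always tag a morphism with its domain and codomain, and an extension with its two end terms.
\<close>

record ('o, 'm) precat =
  Hom :: "'o \<Rightarrow> 'o \<Rightarrow> 'm monoid"
  ide :: "'o \<Rightarrow> 'm"
  cmp :: "'m \<Rightarrow> 'm \<Rightarrow> 'm"  (infixl "\<cdot>\<index>" 70)

definition zero_object :: "('o, 'm, 'z) precat_scheme \<Rightarrow> 'o \<Rightarrow> bool" where
  "zero_object \<C> Z \<longleftrightarrow>
     (\<forall>A. (\<exists>!f. f \<in> carrier (Hom \<C> Z A)) \<and> (\<exists>!f. f \<in> carrier (Hom \<C> A Z)))"

definition biproduct ::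
  "('o, 'm, 'z) precat_scheme \<Rightarrow> 'o \<Rightarrow> 'o \<Rightarrow> 'o \<Rightarrow> 'm \<Rightarrow> 'm \<Rightarrow> 'm \<Rightarrow> 'm \<Rightarrow> bool" where
  "biproduct \<C> A B S i j p q \<longleftrightarrow>
     i \<in> carrier (Hom \<C> A S) \<and> j \<in> carrier (Hom \<C> B S) \<and>
     p \<in> carrier (Hom \<C> S A) \<and> q \<in> carrier (Hom \<C> S B) \<and>
     p \<cdot>\<^bsub>\<C>\<^esub> i = ide \<C> A \<and> q \<cdot>\<^bsub>\<C>\<^esub> j = ide \<C> B \<and>
     p \<cdot>\<^bsub>\<C>\<^esub> j = \<one>\<^bsub>Hom \<C> B A\<^esub> \<and> q \<cdot>\<^bsub>\<C>\<^esub> i = \<one>\<^bsub>Hom \<C> A B\<^esub> \<and>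
     (i \<cdot>\<^bsub>\<C>\<^esub> p) \<otimes>\<^bsub>Hom \<C> S S\<^esub> (j \<cdot>\<^bsub>\<C>\<^esub> q) = ide \<C> S"

definition is_iso :: "('o, 'm, 'z) precat_scheme \<Rightarrow> 'o \<Rightarrow> 'o \<Rightarrow> 'm \<Rightarrow> bool" where
  "is_iso \<C> A B f \<longleftrightarrow> f \<in> carrier (Hom \<C> A B) \<and>
     (\<exists>g \<in> carrier (Hom \<C> B A). g \<cdot>\<^bsub>\<C>\<^esub> f = ide \<C> A \<and> f \<cdot>\<^bsub>\<C>\<^esub> g = ide \<C> B)"

locale additive_category =
  fixes \<C> :: "('o, 'm, 'z) precat_scheme" (structure)
  assumes ide_closed: "ide \<C> A \<in> carrier (Hom \<C> A A)"
    and cmp_closed: "\<lbrakk>f \<in> carrier (Hom \<C> A B); g \<in> carrier (Hom \<C> B C)\<rbrakk>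
          \<Longrightarrow> g \<cdot> f \<in> carrier (Hom \<C> A C)"
    and ide_left: "f \<in> carrier (Hom \<C> A B) \<Longrightarrow> ide \<C> B \<cdot> f = f"
    and ide_right: "f \<in> carrier (Hom \<C> A B) \<Longrightarrow> f \<cdot> ide \<C> A = f"
    and cmp_assoc: "\<lbrakk>f \<in> carrier (Hom \<C> A B); g \<in> carrier (Hom \<C> B C); h \<in> carrier (Hom \<C> C D)\<rbrakk>
          \<Longrightarrow> (h \<cdot> g) \<cdot> f = h \<cdot> (g \<cdot> f)"
    and Hom_comm_group: "comm_group (Hom \<C> A B)"
    and cmp_add_left: "\<lbrakk>f \<in> carrier (Hom \<C> A B); g \<in> carrier (Hom \<C> B C); g' \<in> carrier (Hom \<C> B C)\<rbrakk>
          \<Longrightarrow> (g \<otimes>\<^bsub>Hom \<C> B C\<^esub> g') \<cdot> f = (g \<cdot> f) \<otimes>\<^bsub>Hom \<C> A C\<^esub> (g' \<cdot> f)"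
    and cmp_add_right: "\<lbrakk>f \<in> carrier (Hom \<C> A B); f' \<in> carrier (Hom \<C> A B); g \<in> carrier (Hom \<C> B C)\<rbrakk>
          \<Longrightarrow> g \<cdot> (f \<otimes>\<^bsub>Hom \<C> A B\<^esub> f') = (g \<cdot> f) \<otimes>\<^bsub>Hom \<C> A C\<^esub> (g \<cdot> f')"
    and zero_object_exists: "\<exists>Z. zero_object \<C> Z"
    and biproduct_exists: "\<exists>S i j p q. biproduct \<C> A B S i j p q"

text \<open>
  An additive bifunctor \<open>F : \<C>\<^sup>o\<^sup>p \<times> \<C> \<rightarrow> Ab\<close>, where \<open>F C A\<close> is contravariant in \<open>C\<close> and covariant in
  \<open>A\<close>; \<open>pu a = F(C, a)\<close> and \<open>pl c = F(c, A)\<close>.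
\<close>

locale additive_bifunctor = additive_category \<C>
  for \<C> :: "('o, 'm, 'z) precat_scheme" (structure) +
  fixes F :: "'o \<Rightarrow> 'o \<Rightarrow> 'e monoid"
    and pu :: "'m \<Rightarrow> 'e \<Rightarrow> 'e"
    and pl :: "'m \<Rightarrow> 'e \<Rightarrow> 'e"
  assumes F_comm_group: "comm_group (F C A)"
    and pu_hom: "a \<in> carrier (Hom \<C> A A') \<Longrightarrow> pu a \<in> hom (F C A) (F C A')"
    and pl_hom: "c \<in> carrier (Hom \<C> C' C) \<Longrightarrow> pl c \<in> hom (F C A) (F C' A)"
    and pu_ide: "\<delta> \<in> carrier (F C A) \<Longrightarrow> pu (ide \<C> A) \<delta> = \<delta>"
    and pl_ide: "\<delta> \<in> carrier (F C A) \<Longrightarrow> pl (ide \<C> C) \<delta> = \<delta>"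
    and pu_cmp: "\<lbrakk>\<delta> \<in> carrier (F C A); a \<in> carrier (Hom \<C> A A'); a' \<in> carrier (Hom \<C> A' A'')\<rbrakk>
          \<Longrightarrow> pu (a' \<cdot> a) \<delta> = pu a' (pu a \<delta>)"
    and pl_cmp: "\<lbrakk>\<delta> \<in> carrier (F C A); c \<in> carrier (Hom \<C> C' C); c' \<in> carrier (Hom \<C> C'' C')\<rbrakk>
          \<Longrightarrow> pl (c \<cdot> c') \<delta> = pl c' (pl c \<delta>)"
    and pu_pl: "\<lbrakk>\<delta> \<in> carrier (F C A); a \<in> carrier (Hom \<C> A A'); c \<in> carrier (Hom \<C> C' C)\<rbrakk>
          \<Longrightarrow> pu a (pl c \<delta>) = pl c (pu a \<delta>)"
    and pu_add: "\<lbrakk>\<delta> \<in> carrier (F C A); a \<in> carrier (Hom \<C> A A'); a' \<in> carrier (Hom \<C> A A')\<rbrakk>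
          \<Longrightarrow> pu (a \<otimes>\<^bsub>Hom \<C> A A'\<^esub> a') \<delta> = pu a \<delta> \<otimes>\<^bsub>F C A'\<^esub> pu a' \<delta>"
    and pl_add: "\<lbrakk>\<delta> \<in> carrier (F C A); c \<in> carrier (Hom \<C> C' C); c' \<in> carrier (Hom \<C> C' C)\<rbrakk>
          \<Longrightarrow> pl (c \<otimes>\<^bsub>Hom \<C> C' C\<^esub> c') \<delta> = pl c \<delta> \<otimes>\<^bsub>F C' A\<^esub> pl c' \<delta>"


section \<open>Extriangulated categories\<close>

text \<open>
  \<open>Ext \<C> C A\<close> is \<open>\<E>(C, A)\<close>, \<open>push \<C> a \<delta>\<close> is \<open>a\<^sub>* \<delta>\<close> and \<open>pull \<C> c \<delta>\<close> is \<open>c\<^sup>* \<delta>\<close>.  For \<open>\<delta> \<in> \<E>(C, A)\<close>,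
  \<open>rlz \<C> C A \<delta>\<close> is the equivalence class \<open>\<s>(\<delta>)\<close>, whose element \<open>(x, B, y)\<close> stands for the sequence
  \<open>A \<rightarrow> B \<rightarrow> C\<close> with maps \<open>x\<close> and \<open>y\<close>.
\<close>

record ('o, 'm, 'e) ext_precat = "('o, 'm) precat" +
  Ext :: "'o \<Rightarrow> 'o \<Rightarrow> 'e monoid"
  push :: "'m \<Rightarrow> 'e \<Rightarrow> 'e"
  pull :: "'m \<Rightarrow> 'e \<Rightarrow> 'e"
  rlz :: "'o \<Rightarrow> 'o \<Rightarrow> 'e \<Rightarrow> ('m \<times> 'o \<times> 'm) set"

definition sequences :: "('o, 'm, 'z) precat_scheme \<Rightarrow> 'o \<Rightarrow> 'o \<Rightarrow> ('m \<times> 'o \<times> 'm) set" where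
  "sequences \<C> C A = {(x, B, y). x \<in> carrier (Hom \<C> A B) \<and> y \<in> carrier (Hom \<C> B C)}"

definition seq_equiv ::
  "('o, 'm, 'z) precat_scheme \<Rightarrow> 'o \<Rightarrow> 'o \<Rightarrow> (('m \<times> 'o \<times> 'm) \<times> ('m \<times> 'o \<times> 'm)) set" where
  "seq_equiv \<C> C A =
     {((x, B, y), (x', B', y')). (x, B, y) \<in> sequences \<C> C A \<and> (x', B', y') \<in> sequences \<C> C A \<and>
        (\<exists>b. is_iso \<C> B B' b \<and> b \<cdot>\<^bsub>\<C>\<^esub> x = x' \<and> y' \<cdot>\<^bsub>\<C>\<^esub> b = y)}"

text \<open>
  The tuple \<open>(A, x, B, y, C, \<delta>)\<close> is the \<open>\<E>\<close>-triangle \<open>A \<rightarrow> B \<rightarrow> C \<dashrightarrow>\<close> with maps \<open>x\<close>, \<open>y\<close> and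
  extension \<open>\<delta>\<close>.
\<close>

type_synonym ('o, 'm, 'e) triangle = "'o \<times> 'm \<times> 'o \<times> 'm \<times> 'o \<times> 'e"

definition etriangles :: "('o, 'm, 'e, 'z) ext_precat_scheme \<Rightarrow> ('o, 'm, 'e) triangle set" where
  "etriangles \<C> =
     {(A, x, B, y, C, \<delta>). \<delta> \<in> carrier (Ext \<C> C A) \<and> (x, B, y) \<in> rlz \<C> C A \<delta>}"

text \<open>
  \<open>T''\<close> is a direct sum of the triangles \<open>T\<close> and \<open>T'\<close>, formed with any choice of biproducts
  \<open>SA\<close>, \<open>SB\<close>, \<open>SC\<close> of the terms: its maps are \<open>x \<oplus> x'\<close> and \<open>y \<oplus> y'\<close>, and its extension is
  \<open>\<delta> \<oplus> \<delta>'\<close>, the element of \<open>\<E>(SC, SA)\<close> with components \<open>\<delta>, 0, 0, \<delta>'\<close>.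
\<close>

definition tri_direct_sum ::
  "('o, 'm, 'e, 'z) ext_precat_scheme
     \<Rightarrow> ('o, 'm, 'e) triangle \<Rightarrow> ('o, 'm, 'e) triangle \<Rightarrow> ('o, 'm, 'e) triangle \<Rightarrow> bool" where
  "tri_direct_sum \<C> T T' T'' \<longleftrightarrow>
     (\<exists>A x B y C \<delta> A' x' B' y' C' \<delta>' SA iA jA pA qA SB iB jB pB qB SC iC jC pC qC.
        T = (A, x, B, y, C, \<delta>) \<and> T' = (A', x', B', y', C', \<delta>') \<and>
        biproduct \<C> A A' SA iA jA pA qA \<and>
        biproduct \<C> B B' SB iB jB pB qB \<and>
        biproduct \<C> C C' SC iC jC pC qC \<and>
        T'' =
          (SA, (iB \<cdot>\<^bsub>\<C>\<^esub> x \<cdot>\<^bsub>\<C>\<^esub> pA) \<otimes>\<^bsub>Hom \<C> SA SB\<^esub> (jB \<cdot>\<^bsub>\<C>\<^esub> x' \<cdot>\<^bsub>\<C>\<^esub> qA),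
           SB, (iC \<cdot>\<^bsub>\<C>\<^esub> y \<cdot>\<^bsub>\<C>\<^esub> pB) \<otimes>\<^bsub>Hom \<C> SB SC\<^esub> (jC \<cdot>\<^bsub>\<C>\<^esub> y' \<cdot>\<^bsub>\<C>\<^esub> qB),
           SC, push \<C> iA (pull \<C> pC \<delta>) \<otimes>\<^bsub>Ext \<C> SC SA\<^esub> push \<C> jA (pull \<C> qC \<delta>')))"

locale extriangulated =
  additive_bifunctor \<C> "Ext \<C>" "push \<C>" "pull \<C>"
  for \<C> :: "('o, 'm, 'e, 'z) ext_precat_scheme" (structure) +
  assumes rlz_class: "\<delta> \<in> carrier (Ext \<C> C A) \<Longrightarrow> rlz \<C> C A \<delta> \<in> sequences \<C> C A // seq_equiv \<C> C A"
    and rlz_morphism: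
      "\<lbrakk>(A, x, B, y, C, \<delta>) \<in> etriangles \<C>; (A', x', B', y', C', \<delta>') \<in> etriangles \<C>;
        a \<in> carrier (Hom \<C> A A'); c \<in> carrier (Hom \<C> C C'); push \<C> a \<delta> = pull \<C> c \<delta>'\<rbrakk>
       \<Longrightarrow> \<exists>b \<in> carrier (Hom \<C> B B'). b \<cdot> x = x' \<cdot> a \<and> y' \<cdot> b = c \<cdot> y"
    and rlz_zero:
      "biproduct \<C> A C S i j p q \<Longrightarrow> (A, i, S, q, C, \<one>\<^bsub>Ext \<C> C A\<^esub>) \<in> etriangles \<C>"
    and rlz_sum:
      "\<lbrakk>T \<in> etriangles \<C>; T' \<in> etriangles \<C>; tri_direct_sum \<C> T T' T''\<rbrakk> \<Longrightarrow> T'' \<in> etriangles \<C>"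
    and ET3:
      "\<lbrakk>(A, x, B, y, C, \<delta>) \<in> etriangles \<C>; (A', x', B', y', C', \<delta>') \<in> etriangles \<C>;
        a \<in> carrier (Hom \<C> A A'); b \<in> carrier (Hom \<C> B B'); b \<cdot> x = x' \<cdot> a\<rbrakk>
       \<Longrightarrow> \<exists>c \<in> carrier (Hom \<C> C C'). c \<cdot> y = y' \<cdot> b \<and> push \<C> a \<delta> = pull \<C> c \<delta>'"
    and ET3_op:
      "\<lbrakk>(A, x, B, y, C, \<delta>) \<in> etriangles \<C>; (A', x', B', y', C', \<delta>') \<in> etriangles \<C>;
        b \<in> carrier (Hom \<C> B B'); c \<in> carrier (Hom \<C> C C'); c \<cdot> y = y' \<cdot> b\<rbrakk>
       \<Longrightarrow> \<exists>a \<in> carrier (Hom \<C> A A'). b \<cdot> x = x' \<cdot> a \<and> push \<C> a \<delta> = pull \<C> c \<delta>'"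
    and ET4:
      "\<lbrakk>(A, f, B, f', D, \<delta>) \<in> etriangles \<C>; (B, g, C, g', F, \<delta>') \<in> etriangles \<C>\<rbrakk>
       \<Longrightarrow> \<exists>E \<delta>'' h' d e.
             (A, g \<cdot> f, C, h', E, \<delta>'') \<in> etriangles \<C> \<and>
             (D, d, E, e, F, push \<C> f' \<delta>') \<in> etriangles \<C> \<and>
             h' \<cdot> g = d \<cdot> f' \<and> e \<cdot> h' = g' \<and>
             pull \<C> d \<delta>'' = \<delta> \<and> push \<C> f \<delta>'' = pull \<C> e \<delta>'"
    and ET4_op:
      "\<lbrakk>(D, f', A, f, B, \<delta>) \<in> etriangles \<C>; (F, g', B, g, C, \<delta>') \<in> etriangles \<C>\<rbrakk>
       \<Longrightarrow> \<exists>E \<delta>'' h' d e.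
             (E, h', A, g \<cdot> f, C, \<delta>'') \<in> etriangles \<C> \<and>
             (D, d, E, e, F, pull \<C> g' \<delta>) \<in> etriangles \<C> \<and>
             f \<cdot> h' = g' \<cdot> e \<and> h' \<cdot> d = f' \<and>
             push \<C> e \<delta>'' = \<delta>' \<and> push \<C> d \<delta> = pull \<C> g \<delta>''"


section \<open>Negative first extensions\<close>

text \<open>
  \<open>NExt\<close>, \<open>npush\<close>, \<open>npull\<close> form the bifunctor \<open>\<E>\<^sup>-\<^sup>1\<close>.  For \<open>\<delta> \<in> \<E>(C, A)\<close>, \<open>nsharp_contra \<C> \<delta>\<close> is the
  transformation \<open>\<E>\<^sup>-\<^sup>1(-, C) \<rightarrow> \<C>(-, A)\<close> and \<open>nsharp_co \<C> \<delta>\<close> is the transformation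
  \<open>\<E>\<^sup>-\<^sup>1(A, -) \<rightarrow> \<C>(C, -)\<close>.
\<close>

record ('o, 'm, 'e, 'n) neg_ext_precat = "('o, 'm, 'e) ext_precat" +
  NExt :: "'o \<Rightarrow> 'o \<Rightarrow> 'n monoid"
  npush :: "'m \<Rightarrow> 'n \<Rightarrow> 'n"
  npull :: "'m \<Rightarrow> 'n \<Rightarrow> 'n"
  nsharp_contra :: "'e \<Rightarrow> 'n \<Rightarrow> 'm"
  nsharp_co :: "'e \<Rightarrow> 'n \<Rightarrow> 'm"

locale neg_extriangulated =
  extriangulated \<C> +
  neg: additive_bifunctor \<C> "NExt \<C>" "npush \<C>" "npull \<C>"
  for \<C> :: "('o, 'm, 'e, 'n, 'z) neg_ext_precat_scheme" (structure) +
  assumes nsharp_contra_hom: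
      "\<delta> \<in> carrier (Ext \<C> C A) \<Longrightarrow> nsharp_contra \<C> \<delta> \<in> hom (NExt \<C> W C) (Hom \<C> W A)"
    and nsharp_contra_natural:
      "\<lbrakk>\<delta> \<in> carrier (Ext \<C> C A); u \<in> carrier (NExt \<C> W C); w \<in> carrier (Hom \<C> W' W)\<rbrakk>
       \<Longrightarrow> nsharp_contra \<C> \<delta> (npull \<C> w u) = nsharp_contra \<C> \<delta> u \<cdot> w"
    and nsharp_co_hom:
      "\<delta> \<in> carrier (Ext \<C> C A) \<Longrightarrow> nsharp_co \<C> \<delta> \<in> hom (NExt \<C> A W) (Hom \<C> C W)"
    and nsharp_co_natural:
      "\<lbrakk>\<delta> \<in> carrier (Ext \<C> C A); u \<in> carrier (NExt \<C> A W); w \<in> carrier (Hom \<C> W W')\<rbrakk>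
       \<Longrightarrow> nsharp_co \<C> \<delta> (npush \<C> w u) = w \<cdot> nsharp_co \<C> \<delta> u"
    and exact_co:
      "(A, f, B, g, C, \<delta>) \<in> etriangles \<C> \<Longrightarrow>
         npull \<C> g ` carrier (NExt \<C> C W) = kernel (NExt \<C> B W) (NExt \<C> A W) (npull \<C> f) \<and>
         npull \<C> f ` carrier (NExt \<C> B W) = kernel (NExt \<C> A W) (Hom \<C> C W) (nsharp_co \<C> \<delta>) \<and>
         nsharp_co \<C> \<delta> ` carrier (NExt \<C> A W) = kernel (Hom \<C> C W) (Hom \<C> B W) (\<lambda>h. h \<cdot> g)"
    and exact_contra:
      "(A, f, B, g, C, \<delta>) \<in> etriangles \<C> \<Longrightarrow>
         npush \<C> f ` carrier (NExt \<C> W A) = kernel (NExt \<C> W B) (NExt \<C> W C) (npush \<C> g) \<and>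
         npush \<C> g ` carrier (NExt \<C> W B) = kernel (NExt \<C> W C) (Hom \<C> W A) (nsharp_contra \<C> \<delta>) \<and>
         nsharp_contra \<C> \<delta> ` carrier (NExt \<C> W C) = kernel (Hom \<C> W A) (Hom \<C> W B) (\<lambda>h. f \<cdot> h)"


section \<open>Proper classes\<close>

definition tri_iso ::
  "('o, 'm, 'e, 'z) ext_precat_scheme \<Rightarrow> ('o, 'm, 'e) triangle \<Rightarrow> ('o, 'm, 'e) triangle \<Rightarrow> bool" where
  "tri_iso \<C> T T' \<longleftrightarrow>
     (\<exists>A x B y C \<delta> A' x' B' y' C' \<delta>' a b c.
        T = (A, x, B, y, C, \<delta>) \<and> T' = (A', x', B', y', C', \<delta>') \<and>
        is_iso \<C> A A' a \<and> is_iso \<C> B B' b \<and> is_iso \<C> C C' c \<and>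
        b \<cdot>\<^bsub>\<C>\<^esub> x = x' \<cdot>\<^bsub>\<C>\<^esub> a \<and> c \<cdot>\<^bsub>\<C>\<^esub> y = y' \<cdot>\<^bsub>\<C>\<^esub> b \<and> push \<C> a \<delta> = pull \<C> c \<delta>')"

definition iso_closed ::
  "('o, 'm, 'e, 'z) ext_precat_scheme \<Rightarrow> ('o, 'm, 'e) triangle set \<Rightarrow> bool" where
  "iso_closed \<C> \<xi> \<longleftrightarrow> (\<forall>T \<in> \<xi>. \<forall>T' \<in> etriangles \<C>. tri_iso \<C> T T' \<longrightarrow> T' \<in> \<xi>)"

text \<open>
  The empty coproduct is a split triangle, so binary coproducts suffice for closure under finite
  coproducts once \<open>\<xi>\<close> contains the split triangles.
\<close>

definition coproduct_closed ::
  "('o, 'm, 'e, 'z) ext_precat_scheme \<Rightarrow> ('o, 'm, 'e) triangle set \<Rightarrow> bool" where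
  "coproduct_closed \<C> \<xi> \<longleftrightarrow> (\<forall>T \<in> \<xi>. \<forall>T' \<in> \<xi>. \<forall>T''. tri_direct_sum \<C> T T' T'' \<longrightarrow> T'' \<in> \<xi>)"

definition split_triangles ::
  "('o, 'm, 'e, 'z) ext_precat_scheme \<Rightarrow> ('o, 'm, 'e) triangle set" where
  "split_triangles \<C> = {(A, x, B, y, C, \<delta>) \<in> etriangles \<C>. \<delta> = \<one>\<^bsub>Ext \<C> C A\<^esub>}"

definition base_change_closed ::
  "('o, 'm, 'e, 'z) ext_precat_scheme \<Rightarrow> ('o, 'm, 'e) triangle set \<Rightarrow> bool" where
  "base_change_closed \<C> \<xi> \<longleftrightarrow>
     (\<forall>A x B y C \<delta> C' c x' B' y'.
        (A, x, B, y, C, \<delta>) \<in> \<xi> \<and> c \<in> carrier (Hom \<C> C' C) \<and>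
        (A, x', B', y', C', pull \<C> c \<delta>) \<in> etriangles \<C>
        \<longrightarrow> (A, x', B', y', C', pull \<C> c \<delta>) \<in> \<xi>)"

definition cobase_change_closed ::
  "('o, 'm, 'e, 'z) ext_precat_scheme \<Rightarrow> ('o, 'm, 'e) triangle set \<Rightarrow> bool" where
  "cobase_change_closed \<C> \<xi> \<longleftrightarrow>
     (\<forall>A x B y C \<delta> A' a x' B' y'.
        (A, x, B, y, C, \<delta>) \<in> \<xi> \<and> a \<in> carrier (Hom \<C> A A') \<and>
        (A', x', B', y', C, push \<C> a \<delta>) \<in> etriangles \<C>
        \<longrightarrow> (A', x', B', y', C, push \<C> a \<delta>) \<in> \<xi>)"

definition saturated ::
  "('o, 'm, 'e, 'z) ext_precat_scheme \<Rightarrow> ('o, 'm, 'e) triangle set \<Rightarrow> bool" where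
  "saturated \<C> \<xi> \<longleftrightarrow>
     (\<forall>A1 x1 B1 y1 C \<delta>1 A2 x2 B2 y2 \<delta>2 m M e.
        (A1, x1, B1, y1, C, \<delta>1) \<in> etriangles \<C> \<and>
        (A2, x2, B2, y2, C, \<delta>2) \<in> \<xi> \<and>
        (A1, m, M, e, B2, pull \<C> y2 \<delta>1) \<in> \<xi>
        \<longrightarrow> (A1, x1, B1, y1, C, \<delta>1) \<in> \<xi>)"

definition proper_class ::
  "('o, 'm, 'e, 'z) ext_precat_scheme \<Rightarrow> ('o, 'm, 'e) triangle set \<Rightarrow> bool" where
  "proper_class \<C> \<xi> \<longleftrightarrow>
     \<xi> \<subseteq> etriangles \<C> \<and> iso_closed \<C> \<xi> \<and>
     coproduct_closed \<C> \<xi> \<and> split_triangles \<C> \<subseteq> \<xi> \<and>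
     base_change_closed \<C> \<xi> \<and> cobase_change_closed \<C> \<xi> \<and>
     saturated \<C> \<xi>"


section \<open>Relative projectives and injectives\<close>

text \<open>
  Note the argument order: \<^term>\<open>short_exact_sequence A B C f g\<close> says that
  \<open>0 \<rightarrow> C \<rightarrow> B \<rightarrow> A \<rightarrow> 0\<close>, with maps \<open>g\<close> and \<open>f\<close>, is exact.
\<close>

definition Hom_from_exact ::
  "('o, 'm, 'e, 'z) ext_precat_scheme \<Rightarrow> 'o \<Rightarrow> ('o, 'm, 'e) triangle \<Rightarrow> bool" where
  "Hom_from_exact \<C> X = (\<lambda>(A, x, B, y, C, \<delta>).
     short_exact_sequence (Hom \<C> X C) (Hom \<C> X B) (Hom \<C> X A) (\<lambda>h. y \<cdot>\<^bsub>\<C>\<^esub> h) (\<lambda>h. x \<cdot>\<^bsub>\<C>\<^esub> h))"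

definition Hom_to_exact ::
  "('o, 'm, 'e, 'z) ext_precat_scheme \<Rightarrow> 'o \<Rightarrow> ('o, 'm, 'e) triangle \<Rightarrow> bool" where
  "Hom_to_exact \<C> Y = (\<lambda>(A, x, B, y, C, \<delta>).
     short_exact_sequence (Hom \<C> A Y) (Hom \<C> B Y) (Hom \<C> C Y) (\<lambda>h. h \<cdot>\<^bsub>\<C>\<^esub> x) (\<lambda>h. h \<cdot>\<^bsub>\<C>\<^esub> y))"

definition projectives ::
  "('o, 'm, 'e, 'z) ext_precat_scheme \<Rightarrow> ('o, 'm, 'e) triangle set \<Rightarrow> 'o set" where
  "projectives \<C> \<xi> = {P. \<forall>T \<in> \<xi>. Hom_from_exact \<C> P T}"

definition injectives ::
  "('o, 'm, 'e, 'z) ext_precat_scheme \<Rightarrow> ('o, 'm, 'e) triangle set \<Rightarrow> 'o set" where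
  "injectives \<C> \<xi> = {I. \<forall>T \<in> \<xi>. Hom_to_exact \<C> I T}"

definition enough_projectives ::
  "('o, 'm, 'e, 'z) ext_precat_scheme \<Rightarrow> ('o, 'm, 'e) triangle set \<Rightarrow> bool" where
  "enough_projectives \<C> \<xi> \<longleftrightarrow>
     (\<forall>A. \<exists>K x P y \<delta>. (K, x, P, y, A, \<delta>) \<in> \<xi> \<and> P \<in> projectives \<C> \<xi>)"

definition enough_injectives ::
  "('o, 'm, 'e, 'z) ext_precat_scheme \<Rightarrow> ('o, 'm, 'e) triangle set \<Rightarrow> bool" where
  "enough_injectives \<C> \<xi> \<longleftrightarrow>
     (\<forall>A. \<exists>x I y K \<delta>. (A, x, I, y, K, \<delta>) \<in> \<xi> \<and> I \<in> injectives \<C> \<xi>)"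

definition xi_lower ::
  "('o, 'm, 'e, 'z) ext_precat_scheme \<Rightarrow> 'o set \<Rightarrow> ('o, 'm, 'e) triangle set" where
  "xi_lower \<C> \<X> = {T \<in> etriangles \<C>. \<forall>X \<in> \<X>. Hom_from_exact \<C> X T}"

definition xi_upper ::
  "('o, 'm, 'e, 'z) ext_precat_scheme \<Rightarrow> 'o set \<Rightarrow> ('o, 'm, 'e) triangle set" where
  "xi_upper \<C> \<Y> = {T \<in> etriangles \<C>. \<forall>Y \<in> \<Y>. Hom_to_exact \<C> Y T}"


section \<open>Balanced pairs\<close>

text \<open>Full subcategories are given by their sets of objects.\<close>

definition additive_subcategory :: "('o, 'm, 'z) precat_scheme \<Rightarrow> 'o set \<Rightarrow> bool" where
  "additive_subcategory \<C> \<X> \<longleftrightarrow>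
     (\<exists>Z \<in> \<X>. zero_object \<C> Z) \<and>
     (\<forall>A \<in> \<X>. \<forall>B \<in> \<X>. \<exists>S \<in> \<X>. \<exists>i j p q. biproduct \<C> A B S i j p q)"

definition summand_closed :: "('o, 'm, 'z) precat_scheme \<Rightarrow> 'o set \<Rightarrow> bool" where
  "summand_closed \<C> \<X> \<longleftrightarrow>
     (\<forall>S \<in> \<X>. \<forall>A B i j p q. biproduct \<C> A B S i j p q \<longrightarrow> A \<in> \<X>)"

definition balanced_pair ::
  "('o, 'm, 'e, 'z) ext_precat_scheme \<Rightarrow> 'o set \<Rightarrow> 'o set \<Rightarrow> bool" where
  "balanced_pair \<C> \<X> \<Y> \<longleftrightarrow>
     additive_subcategory \<C> \<X> \<and> summand_closed \<C> \<X> \<and>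
     additive_subcategory \<C> \<Y> \<and> summand_closed \<C> \<Y> \<and>
     xi_lower \<C> \<X> = xi_upper \<C> \<Y> \<and>
     \<X> = projectives \<C> (xi_lower \<C> \<X>) \<and> \<Y> = injectives \<C> (xi_upper \<C> \<Y>) \<and>
     enough_projectives \<C> (xi_lower \<C> \<X>) \<and> enough_injectives \<C> (xi_upper \<C> \<Y>)"

definition balanced_pairs ::
  "('o, 'm, 'e, 'z) ext_precat_scheme \<Rightarrow> ('o set \<times> 'o set) set" where
  "balanced_pairs \<C> = {(\<X>, \<Y>). balanced_pair \<C> \<X> \<Y>}"

definition proper_classes_enough ::
  "('o, 'm, 'e, 'z) ext_precat_scheme \<Rightarrow> ('o, 'm, 'e) triangle set set" where
  "proper_classes_enough \<C> =
     {\<xi>. proper_class \<C> \<xi> \<and> enough_projectives \<C> \<xi> \<and> enough_injectives \<C> \<xi>}"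

definition Psi ::
  "('o, 'm, 'e, 'z) ext_precat_scheme \<Rightarrow> 'o set \<times> 'o set \<Rightarrow> ('o, 'm, 'e) triangle set" where
  "Psi \<C> = (\<lambda>(\<X>, \<Y>). xi_lower \<C> \<X>)"

definition Phi ::
  "('o, 'm, 'e, 'z) ext_precat_scheme \<Rightarrow> ('o, 'm, 'e) triangle set \<Rightarrow> 'o set \<times> 'o set" where
  "Phi \<C> \<xi> = (projectives \<C> \<xi>, injectives \<C> \<xi>)"

end

theory Submission
  imports Defs
begin

text \<open>
  A class \<open>\<xi>\<close> that is closed under cobase change and has enough projectives is determined by its
  projectives.  Indeed, let \<open>A \<rightarrow> B \<rightarrow> C\<close> be a triangle with extension \<open>\<delta>\<close>, and let
  \<open>K \<rightarrow> P \<rightarrow> C\<close> be a triangle of \<open>\<xi>\<close> with \<open>P\<close> projective and extension \<open>\<kappa>\<close>.  As soon as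
  \<open>P \<rightarrow> C\<close> lifts to \<open>B\<close>, the dual of (ET3) gives a map \<open>a : K \<rightarrow> A\<close> with \<open>\<delta> = a\<^sub>* \<kappa>\<close>, so the first
  triangle lies in \<open>\<xi>\<close> (\<open>mem_if_deflation_lifts\<close>).  Hence \<open>\<xi> = \<xi>\<^bsub>\<P>(\<xi>)\<^esub>\<close> for every proper class with
  enough projectives, and dually with base change \<open>\<xi> = \<xi>\<^bsup>\<I>(\<xi>)\<^esup>\<close> if there are enough injectives.
  Together with the closure of relative projectives and injectives under zero objects, biproducts
  and summands, this makes \<open>(\<P>(\<xi>), \<I>(\<xi>))\<close> a balanced pair.

  Conversely let \<open>(\<X>, \<Y>)\<close> be a balanced pair.  The difficulty is that \<open>\<C>(X, -)\<close>-exactness of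
  \<open>A \<rightarrow> B \<rightarrow> C\<close> asks for two things: maps \<open>h : X \<rightarrow> C\<close> lift to \<open>B\<close>, which means \<open>h\<^sup>* \<delta> = 0\<close>, and
  \<open>\<C>(X, A) \<rightarrow> \<C>(X, B)\<close> is injective, which is not visible from \<open>\<delta>\<close>.  The description
  as \<open>\<xi>\<^bsup>\<Y>\<^esup>\<close> resolves this.  A cobase change keeps the end term \<open>C\<close>, and the old deflation
  factors through the new one, so injectivity of \<open>\<C>(C, Y) \<rightarrow> \<C>(B, Y)\<close> is inherited, and
  \<open>\<xi>\<^bsup>\<Y>\<^esup>\<close> is closed under cobase change
  (\<open>xi_upper_cobase_change_closed\<close>).  Then the argument above applies to \<open>\<xi>\<^sub>\<X> = \<xi>\<^bsup>\<Y>\<^esup>\<close>, and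
  a triangle belongs to it as soon as \<open>h\<^sup>* \<delta> = 0\<close> for all \<open>h : X \<rightarrow> C\<close> with \<open>X\<close> in \<open>\<X>\<close>
  (\<open>mem_xi_lower_iff\<close>).  This condition is additive and functorial in \<open>\<delta>\<close>, which gives closure
  under isomorphisms, coproducts and base change, and saturation.
\<close>

section \<open>Zero morphisms and triangles\<close>

context additive_category
begin

lemma group_Hom: "group (Hom \<C> A B)"
  using Hom_comm_group by (simp add: comm_group_def)

lemma zero_closed: "\<one>\<^bsub>Hom \<C> A B\<^esub> \<in> carrier (Hom \<C> A B)"
  by (simp add: group_Hom group.is_monoid)

lemma add_closed:
  "\<lbrakk>f \<in> carrier (Hom \<C> A B); g \<in> carrier (Hom \<C> A B)\<rbrakk> \<Longrightarrow> f \<otimes>\<^bsub>Hom \<C> A B\<^esub> g \<in> carrier (Hom \<C> A B)"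
  by (meson group_Hom group.is_monoid monoid.m_closed)

lemma zero_add_zero: "\<one>\<^bsub>Hom \<C> A B\<^esub> \<otimes>\<^bsub>Hom \<C> A B\<^esub> \<one>\<^bsub>Hom \<C> A B\<^esub> = \<one>\<^bsub>Hom \<C> A B\<^esub>"
  by (simp add: group_Hom group.is_monoid monoid.l_one zero_closed)

lemma postcompose_hom:
  "y \<in> carrier (Hom \<C> B C) \<Longrightarrow> (\<lambda>h. y \<cdot> h) \<in> hom (Hom \<C> X B) (Hom \<C> X C)"
  by (rule homI) (auto simp: cmp_add_right intro: cmp_closed)

lemma precompose_hom:
  "x \<in> carrier (Hom \<C> A B) \<Longrightarrow> (\<lambda>h. h \<cdot> x) \<in> hom (Hom \<C> B Y) (Hom \<C> A Y)"
  by (rule homI) (auto simp: cmp_add_left intro: cmp_closed)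

lemma cmp_zero:
  assumes "y \<in> carrier (Hom \<C> B C)"
  shows "y \<cdot> \<one>\<^bsub>Hom \<C> X B\<^esub> = \<one>\<^bsub>Hom \<C> X C\<^esub>"
  using hom_one[OF postcompose_hom[OF assms] group_Hom group_Hom] .

lemma zero_cmp:
  assumes "x \<in> carrier (Hom \<C> A B)"
  shows "\<one>\<^bsub>Hom \<C> B Y\<^esub> \<cdot> x = \<one>\<^bsub>Hom \<C> A Y\<^esub>"
  using hom_one[OF precompose_hom[OF assms] group_Hom group_Hom] .

lemma to_zero_object_unique:
  assumes "zero_object \<C> Z" "f \<in> carrier (Hom \<C> A Z)"
  shows "f = \<one>\<^bsub>Hom \<C> A Z\<^esub>"
  using assms zero_closed unfolding zero_object_def by blast

lemma from_zero_object_unique: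
  assumes "zero_object \<C> Z" "f \<in> carrier (Hom \<C> Z A)"
  shows "f = \<one>\<^bsub>Hom \<C> Z A\<^esub>"
  using assms zero_closed unfolding zero_object_def by blast

lemma from_biproduct_decompose:
  assumes "biproduct \<C> A B S i j p q" "h \<in> carrier (Hom \<C> S D)"
  shows "h = ((h \<cdot> i) \<cdot> p) \<otimes>\<^bsub>Hom \<C> S D\<^esub> ((h \<cdot> j) \<cdot> q)"
proof -
  have c: "i \<in> carrier (Hom \<C> A S)" "j \<in> carrier (Hom \<C> B S)"
      "p \<in> carrier (Hom \<C> S A)" "q \<in> carrier (Hom \<C> S B)"
      and e: "(i \<cdot> p) \<otimes>\<^bsub>Hom \<C> S S\<^esub> (j \<cdot> q) = ide \<C> S"
    using assms(1) by (auto simp: biproduct_def)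
  have "h = h \<cdot> ((i \<cdot> p) \<otimes>\<^bsub>Hom \<C> S S\<^esub> (j \<cdot> q))"
    using assms(2) e by (simp add: ide_right)
  also have "\<dots> = (h \<cdot> (i \<cdot> p)) \<otimes>\<^bsub>Hom \<C> S D\<^esub> (h \<cdot> (j \<cdot> q))"
    using assms(2) c by (intro cmp_add_right) (auto intro: cmp_closed)
  also have "\<dots> = ((h \<cdot> i) \<cdot> p) \<otimes>\<^bsub>Hom \<C> S D\<^esub> ((h \<cdot> j) \<cdot> q)"
    using cmp_assoc[OF c(3,1) assms(2)] cmp_assoc[OF c(4,2) assms(2)] by simp
  finally show ?thesis .
qed

lemma to_biproduct_decompose:
  assumes "biproduct \<C> A B S i j p q" "h \<in> carrier (Hom \<C> D S)"
  shows "h = (i \<cdot> (p \<cdot> h)) \<otimes>\<^bsub>Hom \<C> D S\<^esub> (j \<cdot> (q \<cdot> h))"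
proof -
  have c: "i \<in> carrier (Hom \<C> A S)" "j \<in> carrier (Hom \<C> B S)"
      "p \<in> carrier (Hom \<C> S A)" "q \<in> carrier (Hom \<C> S B)"
      and e: "(i \<cdot> p) \<otimes>\<^bsub>Hom \<C> S S\<^esub> (j \<cdot> q) = ide \<C> S"
    using assms(1) by (auto simp: biproduct_def)
  have "h = ((i \<cdot> p) \<otimes>\<^bsub>Hom \<C> S S\<^esub> (j \<cdot> q)) \<cdot> h"
    using assms(2) e by (simp add: ide_left)
  also have "\<dots> = ((i \<cdot> p) \<cdot> h) \<otimes>\<^bsub>Hom \<C> D S\<^esub> ((j \<cdot> q) \<cdot> h)"
    using assms(2) c by (intro cmp_add_left) (auto intro: cmp_closed)
  also have "\<dots> = (i \<cdot> (p \<cdot> h)) \<otimes>\<^bsub>Hom \<C> D S\<^esub> (j \<cdot> (q \<cdot> h))"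
    using cmp_assoc[OF assms(2) c(3,1)] cmp_assoc[OF assms(2) c(4,2)] by simp
  finally show ?thesis .
qed

end

context extriangulated
begin

lemma group_Ext: "group (Ext \<C> C A)"
  using F_comm_group by (simp add: comm_group_def)

lemma Ext_zero_closed: "\<one>\<^bsub>Ext \<C> C A\<^esub> \<in> carrier (Ext \<C> C A)"
  by (simp add: group_Ext group.is_monoid)

lemma push_closed:
  "\<lbrakk>\<delta> \<in> carrier (Ext \<C> C A); a \<in> carrier (Hom \<C> A A')\<rbrakk> \<Longrightarrow> push \<C> a \<delta> \<in> carrier (Ext \<C> C A')"
  using pu_hom hom_carrier by fast

lemma pull_closed:
  "\<lbrakk>\<delta> \<in> carrier (Ext \<C> C A); c \<in> carrier (Hom \<C> C' C)\<rbrakk> \<Longrightarrow> pull \<C> c \<delta> \<in> carrier (Ext \<C> C' A)"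
  using pl_hom hom_carrier by fast

lemma push_zero: "a \<in> carrier (Hom \<C> A A') \<Longrightarrow> push \<C> a \<one>\<^bsub>Ext \<C> C A\<^esub> = \<one>\<^bsub>Ext \<C> C A'\<^esub>"
  using hom_one[OF pu_hom group_Ext group_Ext] .

lemma pull_zero: "c \<in> carrier (Hom \<C> C' C) \<Longrightarrow> pull \<C> c \<one>\<^bsub>Ext \<C> C A\<^esub> = \<one>\<^bsub>Ext \<C> C' A\<^esub>"
  using hom_one[OF pl_hom group_Ext group_Ext] .

lemma etriangleD:
  assumes "(A, x, B, y, C, \<delta>) \<in> etriangles \<C>"
  shows "x \<in> carrier (Hom \<C> A B)" "y \<in> carrier (Hom \<C> B C)" "\<delta> \<in> carrier (Ext \<C> C A)"
proof -
  have d: "\<delta> \<in> carrier (Ext \<C> C A)" "(x, B, y) \<in> rlz \<C> C A \<delta>"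
    using assms by (auto simp: etriangles_def)
  have "(x, B, y) \<in> sequences \<C> C A"
    using d(2) rlz_class[OF d(1)] by (auto simp: quotient_def seq_equiv_def)
  then show "x \<in> carrier (Hom \<C> A B)" "y \<in> carrier (Hom \<C> B C)" "\<delta> \<in> carrier (Ext \<C> C A)"
    using d(1) by (auto simp: sequences_def)
qed


section \<open>Exactness of Hom on triangles\<close>

text \<open>
  A split triangle ending or starting in a zero object has an isomorphism as its other map.  Mapping
  it to or from a given triangle turns (ET3) and its dual into statements about single composites.
\<close>

lemma triangle_cmp_zero:
  assumes T: "(A, x, B, y, C, \<delta>) \<in> etriangles \<C>"
  shows "y \<cdot> x = \<one>\<^bsub>Hom \<C> A C\<^esub>"
proof -
  note TD = etriangleD[OF T]
  obtain Z where Z: "zero_object \<C> Z" using zero_object_exists by blast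
  obtain S i j p q where bp: "biproduct \<C> A Z S i j p q" using biproduct_exists by blast
  then have c: "i \<in> carrier (Hom \<C> A S)" "p \<in> carrier (Hom \<C> S A)" "q \<in> carrier (Hom \<C> S Z)"
      and e: "p \<cdot> i = ide \<C> A" "q \<cdot> i = \<one>\<^bsub>Hom \<C> A Z\<^esub>"
    by (auto simp: biproduct_def)
  have xp: "x \<cdot> p \<in> carrier (Hom \<C> S B)" using c TD cmp_closed by blast
  have xpi: "(x \<cdot> p) \<cdot> i = x" using c TD e by (simp add: cmp_assoc[OF c(1,2) TD(1)] ide_right)
  then have "(x \<cdot> p) \<cdot> i = x \<cdot> ide \<C> A" using TD by (simp add: ide_right)
  then obtain z where z: "z \<in> carrier (Hom \<C> Z C)" "z \<cdot> q = y \<cdot> (x \<cdot> p)"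
    using ET3[OF rlz_zero[OF bp] T ide_closed xp] by blast
  have "y \<cdot> x = (z \<cdot> q) \<cdot> i"
    using cmp_assoc[OF c(1) xp TD(2)] xpi z(2) by simp
  also have "\<dots> = \<one>\<^bsub>Hom \<C> A C\<^esub>"
    using cmp_assoc[OF c(1,3) z(1)] e(2) cmp_zero[OF z(1)] by simp
  finally show ?thesis .
qed

lemma factors_through_inflation:
  assumes T: "(A, x, B, y, C, \<delta>) \<in> etriangles \<C>"
    and h: "h \<in> carrier (Hom \<C> X B)" "y \<cdot> h = \<one>\<^bsub>Hom \<C> X C\<^esub>"
  shows "\<exists>k \<in> carrier (Hom \<C> X A). x \<cdot> k = h"
proof -
  note TD = etriangleD[OF T]
  obtain Z where Z: "zero_object \<C> Z" using zero_object_exists by blast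
  obtain S i j p q where bp: "biproduct \<C> X Z S i j p q" using biproduct_exists by blast
  then have c: "i \<in> carrier (Hom \<C> X S)" "p \<in> carrier (Hom \<C> S X)" "q \<in> carrier (Hom \<C> S Z)"
      and e: "p \<cdot> i = ide \<C> X"
    by (auto simp: biproduct_def)
  have hp: "h \<cdot> p \<in> carrier (Hom \<C> S B)" using c h cmp_closed by blast
  have "\<one>\<^bsub>Hom \<C> Z C\<^esub> \<cdot> q = y \<cdot> (h \<cdot> p)"
    using zero_cmp[OF c(3)] zero_cmp[OF c(2)] cmp_assoc[OF c(2) h(1) TD(2)] h(2) by simp
  then obtain k where "k \<in> carrier (Hom \<C> X A)" "(h \<cdot> p) \<cdot> i = x \<cdot> k"
    using ET3_op[OF rlz_zero[OF bp] T hp zero_closed] by blast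
  moreover have "(h \<cdot> p) \<cdot> i = h"
    using cmp_assoc[OF c(1,2) h(1)] e h(1) by (simp add: ide_right)
  ultimately show ?thesis by metis
qed

lemma factors_through_deflation:
  assumes T: "(A, x, B, y, C, \<delta>) \<in> etriangles \<C>"
    and h: "h \<in> carrier (Hom \<C> B Y)" "h \<cdot> x = \<one>\<^bsub>Hom \<C> A Y\<^esub>"
  shows "\<exists>k \<in> carrier (Hom \<C> C Y). k \<cdot> y = h"
proof -
  note TD = etriangleD[OF T]
  obtain Z where Z: "zero_object \<C> Z" using zero_object_exists by blast
  obtain S i j p q where bp: "biproduct \<C> Z Y S i j p q" using biproduct_exists by blast
  then have c: "i \<in> carrier (Hom \<C> Z S)" "j \<in> carrier (Hom \<C> Y S)" "q \<in> carrier (Hom \<C> S Y)"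
      and e: "q \<cdot> j = ide \<C> Y"
    by (auto simp: biproduct_def)
  have jh: "j \<cdot> h \<in> carrier (Hom \<C> B S)" using c h cmp_closed by blast
  have "(j \<cdot> h) \<cdot> x = i \<cdot> \<one>\<^bsub>Hom \<C> A Z\<^esub>"
    using cmp_zero[OF c(1)] cmp_zero[OF c(2)] cmp_assoc[OF TD(1) h(1) c(2)] h(2) by simp
  then obtain k where "k \<in> carrier (Hom \<C> C Y)" "k \<cdot> y = q \<cdot> (j \<cdot> h)"
    using ET3[OF T rlz_zero[OF bp] zero_closed jh] by blast
  moreover have "q \<cdot> (j \<cdot> h) = h"
    using cmp_assoc[OF h(1) c(2,3)] e h(1) by (simp add: ide_left)
  ultimately show ?thesis by metis
qed

text \<open>
  \<open>\<C>(X, -)\<close> and \<open>\<C>(-, Y)\<close> are exact in the middle of every triangle, so only the two ends of the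
  short exact sequences carry information.
\<close>

lemma Hom_from_exact_iff:
  assumes T: "(A, x, B, y, C, \<delta>) \<in> etriangles \<C>"
  shows "Hom_from_exact \<C> X (A, x, B, y, C, \<delta>) \<longleftrightarrow>
    (\<forall>u \<in> carrier (Hom \<C> X A). x \<cdot> u = \<one>\<^bsub>Hom \<C> X B\<^esub> \<longrightarrow> u = \<one>\<^bsub>Hom \<C> X A\<^esub>) \<and>
    (\<forall>h \<in> carrier (Hom \<C> X C). \<exists>k \<in> carrier (Hom \<C> X B). y \<cdot> k = h)"
proof -
  note TD = etriangleD[OF T]
  note hx = postcompose_hom[OF TD(1), of X] and hy = postcompose_hom[OF TD(2), of X]
  have ker: "kernel (Hom \<C> X B) (Hom \<C> X C) (\<lambda>h. y \<cdot> h) = (\<lambda>h. x \<cdot> h) ` carrier (Hom \<C> X A)"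
    unfolding kernel_def
    using factors_through_inflation[OF T, of _ X] TD cmp_assoc[OF _ TD(1,2)]
      triangle_cmp_zero[OF T] zero_cmp
    by (auto intro: cmp_closed)
  have "group_hom (Hom \<C> X A) (Hom \<C> X B) (\<lambda>h. x \<cdot> h)"
    using hx group_Hom by (simp add: group_hom_def group_hom_axioms_def)
  then have ex: "exact_seq ([Hom \<C> X C, Hom \<C> X B, Hom \<C> X A], [\<lambda>h. y \<cdot> h, \<lambda>h. x \<cdot> h])"
    using hy ker group_Hom by simp
  have mon: "(\<lambda>h. x \<cdot> h) \<in> mon (Hom \<C> X A) (Hom \<C> X B) \<longleftrightarrow>
      (\<forall>u \<in> carrier (Hom \<C> X A). x \<cdot> u = \<one>\<^bsub>Hom \<C> X B\<^esub> \<longrightarrow> u = \<one>\<^bsub>Hom \<C> X A\<^esub>)"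
    using hx by (auto simp: mon_iff_hom_one[OF group_Hom group_Hom])
  have epi: "(\<lambda>h. y \<cdot> h) \<in> epi (Hom \<C> X B) (Hom \<C> X C) \<longleftrightarrow>
      (\<forall>h \<in> carrier (Hom \<C> X C). \<exists>k \<in> carrier (Hom \<C> X B). y \<cdot> k = h)"
    using hy hom_carrier[OF hy] by (auto simp: epi_def image_iff) (metis imageE subsetD)+
  show ?thesis
    using ex mon epi by (auto simp only: Hom_from_exact_def short_exact_sequence_iff prod.case)
qed

lemma Hom_to_exact_iff:
  assumes T: "(A, x, B, y, C, \<delta>) \<in> etriangles \<C>"
  shows "Hom_to_exact \<C> Y (A, x, B, y, C, \<delta>) \<longleftrightarrow>
    (\<forall>u \<in> carrier (Hom \<C> C Y). u \<cdot> y = \<one>\<^bsub>Hom \<C> B Y\<^esub> \<longrightarrow> u = \<one>\<^bsub>Hom \<C> C Y\<^esub>) \<and>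
    (\<forall>h \<in> carrier (Hom \<C> A Y). \<exists>k \<in> carrier (Hom \<C> B Y). k \<cdot> x = h)"
proof -
  note TD = etriangleD[OF T]
  note hx = precompose_hom[OF TD(1), of Y] and hy = precompose_hom[OF TD(2), of Y]
  have ker: "kernel (Hom \<C> B Y) (Hom \<C> A Y) (\<lambda>h. h \<cdot> x) = (\<lambda>h. h \<cdot> y) ` carrier (Hom \<C> C Y)"
    unfolding kernel_def
    using factors_through_deflation[OF T, of _ Y] TD cmp_assoc[OF TD(1,2)]
      triangle_cmp_zero[OF T] cmp_zero
    by (auto intro: cmp_closed)
  have "group_hom (Hom \<C> C Y) (Hom \<C> B Y) (\<lambda>h. h \<cdot> y)"
    using hy group_Hom by (simp add: group_hom_def group_hom_axioms_def)
  then have ex: "exact_seq ([Hom \<C> A Y, Hom \<C> B Y, Hom \<C> C Y], [\<lambda>h. h \<cdot> x, \<lambda>h. h \<cdot> y])"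
    using hx ker group_Hom by simp
  have mon: "(\<lambda>h. h \<cdot> y) \<in> mon (Hom \<C> C Y) (Hom \<C> B Y) \<longleftrightarrow>
      (\<forall>u \<in> carrier (Hom \<C> C Y). u \<cdot> y = \<one>\<^bsub>Hom \<C> B Y\<^esub> \<longrightarrow> u = \<one>\<^bsub>Hom \<C> C Y\<^esub>)"
    using hy by (auto simp: mon_iff_hom_one[OF group_Hom group_Hom])
  have epi: "(\<lambda>h. h \<cdot> x) \<in> epi (Hom \<C> B Y) (Hom \<C> A Y) \<longleftrightarrow>
      (\<forall>h \<in> carrier (Hom \<C> A Y). \<exists>k \<in> carrier (Hom \<C> B Y). k \<cdot> x = h)"
    using hx hom_carrier[OF hx] by (auto simp: epi_def image_iff) (metis imageE subsetD)+
  show ?thesis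
    using ex mon epi by (auto simp only: Hom_to_exact_def short_exact_sequence_iff prod.case)
qed


section \<open>Lifting, extension and vanishing of extensions\<close>

text \<open>
  Comparing the triangle with split ones, by the morphism axiom and its converses, turns lifting and
  extension problems into equations in \<open>\<E>\<close>, where base and cobase change are computed
  functorially.
\<close>

lemma lifts_iff_pull_zero:
  assumes T: "(A, x, B, y, C, \<delta>) \<in> etriangles \<C>" and h: "h \<in> carrier (Hom \<C> X C)"
  shows "(\<exists>k \<in> carrier (Hom \<C> X B). y \<cdot> k = h) \<longleftrightarrow> pull \<C> h \<delta> = \<one>\<^bsub>Ext \<C> X A\<^esub>"
proof
  note TD = etriangleD[OF T]
  assume "\<exists>k \<in> carrier (Hom \<C> X B). y \<cdot> k = h"
  then obtain k where k: "k \<in> carrier (Hom \<C> X B)" "y \<cdot> k = h" by blast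
  obtain S i j p q where bp: "biproduct \<C> A B S i j p q" using biproduct_exists by blast
  then have q: "q \<in> carrier (Hom \<C> S B)" by (auto simp: biproduct_def)
  \<comment> \<open>The pair \<open>(q, y)\<close> maps the split triangle on \<open>A\<close> and \<open>B\<close> to the given one, so \<open>y\<^sup>* \<delta> = 0\<close>.\<close>
  obtain a where "a \<in> carrier (Hom \<C> A A)" "push \<C> a \<one>\<^bsub>Ext \<C> B A\<^esub> = pull \<C> y \<delta>"
    using ET3_op[OF rlz_zero[OF bp] T q TD(2) refl] by blast
  then have "pull \<C> y \<delta> = \<one>\<^bsub>Ext \<C> B A\<^esub>" using push_zero by metis
  then show "pull \<C> h \<delta> = \<one>\<^bsub>Ext \<C> X A\<^esub>"
    using pl_cmp[OF TD(3,2) k(1)] k pull_zero by simp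
next
  note TD = etriangleD[OF T]
  assume z: "pull \<C> h \<delta> = \<one>\<^bsub>Ext \<C> X A\<^esub>"
  obtain S i j p q where bp: "biproduct \<C> A X S i j p q" using biproduct_exists by blast
  then have c: "j \<in> carrier (Hom \<C> X S)" "q \<in> carrier (Hom \<C> S X)" and e: "q \<cdot> j = ide \<C> X"
    by (auto simp: biproduct_def)
  have "push \<C> (ide \<C> A) \<one>\<^bsub>Ext \<C> X A\<^esub> = pull \<C> h \<delta>"
    using z push_zero[OF ide_closed] by simp
  then obtain b where b: "b \<in> carrier (Hom \<C> S B)" "y \<cdot> b = h \<cdot> q"
    using rlz_morphism[OF rlz_zero[OF bp] T ide_closed h] by blast
  have "y \<cdot> (b \<cdot> j) = h"
    using cmp_assoc[OF c(1) b(1) TD(2)] cmp_assoc[OF c h] b(2) e h by (simp add: ide_right)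
  then show "\<exists>k \<in> carrier (Hom \<C> X B). y \<cdot> k = h"
    using cmp_closed[OF c(1) b(1)] by blast
qed

lemma extends_iff_push_zero:
  assumes T: "(A, x, B, y, C, \<delta>) \<in> etriangles \<C>" and h: "h \<in> carrier (Hom \<C> A Y)"
  shows "(\<exists>k \<in> carrier (Hom \<C> B Y). k \<cdot> x = h) \<longleftrightarrow> push \<C> h \<delta> = \<one>\<^bsub>Ext \<C> C Y\<^esub>"
proof
  note TD = etriangleD[OF T]
  assume "\<exists>k \<in> carrier (Hom \<C> B Y). k \<cdot> x = h"
  then obtain k where k: "k \<in> carrier (Hom \<C> B Y)" "k \<cdot> x = h" by blast
  obtain S i j p q where bp: "biproduct \<C> B C S i j p q" using biproduct_exists by blast
  then have i: "i \<in> carrier (Hom \<C> B S)" by (auto simp: biproduct_def)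
  obtain c where "c \<in> carrier (Hom \<C> C C)" "push \<C> x \<delta> = pull \<C> c \<one>\<^bsub>Ext \<C> C B\<^esub>"
    using ET3[OF T rlz_zero[OF bp] TD(1) i refl] by blast
  then have "push \<C> x \<delta> = \<one>\<^bsub>Ext \<C> C B\<^esub>" using pull_zero by metis
  then show "push \<C> h \<delta> = \<one>\<^bsub>Ext \<C> C Y\<^esub>"
    using pu_cmp[OF TD(3,1) k(1)] k push_zero by simp
next
  note TD = etriangleD[OF T]
  assume z: "push \<C> h \<delta> = \<one>\<^bsub>Ext \<C> C Y\<^esub>"
  obtain S i j p q where bp: "biproduct \<C> Y C S i j p q" using biproduct_exists by blast
  then have c: "i \<in> carrier (Hom \<C> Y S)" "p \<in> carrier (Hom \<C> S Y)" and e: "p \<cdot> i = ide \<C> Y"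
    by (auto simp: biproduct_def)
  have "push \<C> h \<delta> = pull \<C> (ide \<C> C) \<one>\<^bsub>Ext \<C> C Y\<^esub>"
    using z pull_zero[OF ide_closed] by simp
  then obtain b where b: "b \<in> carrier (Hom \<C> B S)" "b \<cdot> x = i \<cdot> h"
    using rlz_morphism[OF T rlz_zero[OF bp] h ide_closed] by blast
  have "(p \<cdot> b) \<cdot> x = h"
    using cmp_assoc[OF TD(1) b(1) c(2)] cmp_assoc[OF h c] b(2) e h by (simp add: ide_left)
  then show "\<exists>k \<in> carrier (Hom \<C> B Y). k \<cdot> x = h"
    using cmp_closed[OF b(1) c(2)] by blast
qed


section \<open>Classes determined by their projectives or injectives\<close>

text \<open>
  A lift of \<open>p\<close> through \<open>y\<close> exhibits \<open>\<delta>\<close> as a cobase change of \<open>\<kappa>\<close>.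
\<close>

lemma mem_if_deflation_lifts:
  assumes \<xi>: "cobase_change_closed \<C> \<xi>" "\<xi> \<subseteq> etriangles \<C>"
    and K: "(K, w, P, p, C, \<kappa>) \<in> \<xi>" and T: "(A, x, B, y, C, \<delta>) \<in> etriangles \<C>"
    and b: "b \<in> carrier (Hom \<C> P B)" "y \<cdot> b = p"
  shows "(A, x, B, y, C, \<delta>) \<in> \<xi>"
proof -
  have Ke: "(K, w, P, p, C, \<kappa>) \<in> etriangles \<C>" using K \<xi> by blast
  have "ide \<C> C \<cdot> p = y \<cdot> b" using b etriangleD[OF Ke] by (simp add: ide_left)
  then obtain a where a: "a \<in> carrier (Hom \<C> K A)" "push \<C> a \<kappa> = pull \<C> (ide \<C> C) \<delta>"
    using ET3_op[OF Ke T b(1) ide_closed] by blast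
  then have "\<delta> = push \<C> a \<kappa>" using etriangleD[OF T] by (simp add: pl_ide)
  then show ?thesis
    using \<xi>(1) K a(1) T unfolding cobase_change_closed_def by blast
qed

text \<open>Dually, an extension of \<open>i\<close> along \<open>x\<close> exhibits \<open>\<delta>\<close> as a base change of \<open>\<kappa>\<close>.\<close>

lemma mem_if_inflation_extends:
  assumes \<xi>: "base_change_closed \<C> \<xi>" "\<xi> \<subseteq> etriangles \<C>"
    and K: "(A, i, I, w, K, \<kappa>) \<in> \<xi>" and T: "(A, x, B, y, C, \<delta>) \<in> etriangles \<C>"
    and b: "b \<in> carrier (Hom \<C> B I)" "b \<cdot> x = i"
  shows "(A, x, B, y, C, \<delta>) \<in> \<xi>"
proof -
  have Ke: "(A, i, I, w, K, \<kappa>) \<in> etriangles \<C>" using K \<xi> by blast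
  have "b \<cdot> x = i \<cdot> ide \<C> A" using b etriangleD[OF Ke] by (simp add: ide_right)
  then obtain c where c: "c \<in> carrier (Hom \<C> C K)" "push \<C> (ide \<C> A) \<delta> = pull \<C> c \<kappa>"
    using ET3[OF T Ke ide_closed b(1)] by blast
  then have "\<delta> = pull \<C> c \<kappa>" using etriangleD[OF T] by (simp add: pu_ide)
  then show ?thesis
    using \<xi>(1) K c(1) T unfolding base_change_closed_def by blast
qed

text \<open>
  The two inclusions are the unit of the Galois connection between classes and their projectives,
  and \<open>mem_if_deflation_lifts\<close> applied to a projective presentation of the end term.
\<close>

lemma xi_lower_projectives:
  assumes \<xi>: "cobase_change_closed \<C> \<xi>" "\<xi> \<subseteq> etriangles \<C>" and enough: "enough_projectives \<C> \<xi>"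
  shows "xi_lower \<C> (projectives \<C> \<xi>) = \<xi>"
proof
  show "\<xi> \<subseteq> xi_lower \<C> (projectives \<C> \<xi>)"
    using \<xi>(2) by (auto simp: xi_lower_def projectives_def)
  show "xi_lower \<C> (projectives \<C> \<xi>) \<subseteq> \<xi>"
  proof
    fix T assume T: "T \<in> xi_lower \<C> (projectives \<C> \<xi>)"
    obtain A x B y C \<delta> where Teq: "T = (A, x, B, y, C, \<delta>)" by (cases T) auto
    have Te: "(A, x, B, y, C, \<delta>) \<in> etriangles \<C>" using T Teq by (auto simp: xi_lower_def)
    obtain K w P p \<kappa> where K: "(K, w, P, p, C, \<kappa>) \<in> \<xi>" and P: "P \<in> projectives \<C> \<xi>"
      using enough unfolding enough_projectives_def by blast
    have p: "p \<in> carrier (Hom \<C> P C)" using K \<xi>(2) etriangleD by blast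
    have "Hom_from_exact \<C> P (A, x, B, y, C, \<delta>)" using T Teq P by (auto simp: xi_lower_def)
    then obtain b where "b \<in> carrier (Hom \<C> P B)" "y \<cdot> b = p"
      using Hom_from_exact_iff[OF Te] p by blast
    then show "T \<in> \<xi>" using mem_if_deflation_lifts[OF \<xi> K Te] Teq by blast
  qed
qed

lemma xi_upper_injectives:
  assumes \<xi>: "base_change_closed \<C> \<xi>" "\<xi> \<subseteq> etriangles \<C>" and enough: "enough_injectives \<C> \<xi>"
  shows "xi_upper \<C> (injectives \<C> \<xi>) = \<xi>"
proof
  show "\<xi> \<subseteq> xi_upper \<C> (injectives \<C> \<xi>)"
    using \<xi>(2) by (auto simp: xi_upper_def injectives_def)
  show "xi_upper \<C> (injectives \<C> \<xi>) \<subseteq> \<xi>"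
  proof
    fix T assume T: "T \<in> xi_upper \<C> (injectives \<C> \<xi>)"
    obtain A x B y C \<delta> where Teq: "T = (A, x, B, y, C, \<delta>)" by (cases T) auto
    have Te: "(A, x, B, y, C, \<delta>) \<in> etriangles \<C>" using T Teq by (auto simp: xi_upper_def)
    obtain i I w K \<kappa> where K: "(A, i, I, w, K, \<kappa>) \<in> \<xi>" and I: "I \<in> injectives \<C> \<xi>"
      using enough unfolding enough_injectives_def by blast
    have i: "i \<in> carrier (Hom \<C> A I)" using K \<xi>(2) etriangleD by blast
    have "Hom_to_exact \<C> I (A, x, B, y, C, \<delta>)" using T Teq I by (auto simp: xi_upper_def)
    then obtain b where "b \<in> carrier (Hom \<C> B I)" "b \<cdot> x = i"
      using Hom_to_exact_iff[OF Te] i by blast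
    then show "T \<in> \<xi>" using mem_if_inflation_extends[OF \<xi> K Te] Teq by blast
  qed
qed


section \<open>Relative projectives and injectives form additive subcategories\<close>

lemma Hom_from_exact_zero_object:
  assumes "zero_object \<C> Z" and T: "(A, x, B, y, C, \<delta>) \<in> etriangles \<C>"
  shows "Hom_from_exact \<C> Z (A, x, B, y, C, \<delta>)"
  unfolding Hom_from_exact_iff[OF T]
  using from_zero_object_unique[OF assms(1)] cmp_zero[OF etriangleD(2)[OF T]] zero_closed by metis

lemma Hom_to_exact_zero_object:
  assumes "zero_object \<C> Z" and T: "(A, x, B, y, C, \<delta>) \<in> etriangles \<C>"
  shows "Hom_to_exact \<C> Z (A, x, B, y, C, \<delta>)"
  unfolding Hom_to_exact_iff[OF T]
  using to_zero_object_unique[OF assms(1)] zero_cmp[OF etriangleD(1)[OF T]] zero_closed by metis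

lemma Hom_from_exact_biproduct:
  assumes T: "(A, x, B, y, C, \<delta>) \<in> etriangles \<C>" and bp: "biproduct \<C> X X' S i j p q"
    and X: "Hom_from_exact \<C> X (A, x, B, y, C, \<delta>)" "Hom_from_exact \<C> X' (A, x, B, y, C, \<delta>)"
  shows "Hom_from_exact \<C> S (A, x, B, y, C, \<delta>)"
  unfolding Hom_from_exact_iff[OF T]
proof (intro conjI ballI impI)
  note TD = etriangleD[OF T]
  have c: "i \<in> carrier (Hom \<C> X S)" "j \<in> carrier (Hom \<C> X' S)"
      "p \<in> carrier (Hom \<C> S X)" "q \<in> carrier (Hom \<C> S X')"
    using bp by (auto simp: biproduct_def)
  {
    fix u assume u: "u \<in> carrier (Hom \<C> S A)" "x \<cdot> u = \<one>\<^bsub>Hom \<C> S B\<^esub>"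
    have "x \<cdot> (u \<cdot> i) = \<one>\<^bsub>Hom \<C> X B\<^esub>" "x \<cdot> (u \<cdot> j) = \<one>\<^bsub>Hom \<C> X' B\<^esub>"
      using cmp_assoc[OF c(1) u(1) TD(1)] cmp_assoc[OF c(2) u(1) TD(1)] u(2)
        zero_cmp[OF c(1)] zero_cmp[OF c(2)] by auto
    then have "u \<cdot> i = \<one>\<^bsub>Hom \<C> X A\<^esub>" "u \<cdot> j = \<one>\<^bsub>Hom \<C> X' A\<^esub>"
      using X cmp_closed[OF c(1) u(1)] cmp_closed[OF c(2) u(1)]
      unfolding Hom_from_exact_iff[OF T] by blast+
    then show "u = \<one>\<^bsub>Hom \<C> S A\<^esub>"
      using from_biproduct_decompose[OF bp u(1)] zero_cmp[OF c(3)] zero_cmp[OF c(4)] zero_add_zero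
      by simp
  next
    fix h assume h: "h \<in> carrier (Hom \<C> S C)"
    obtain k k' where k: "k \<in> carrier (Hom \<C> X B)" "y \<cdot> k = h \<cdot> i"
      "k' \<in> carrier (Hom \<C> X' B)" "y \<cdot> k' = h \<cdot> j"
      using X cmp_closed[OF c(1) h] cmp_closed[OF c(2) h]
      unfolding Hom_from_exact_iff[OF T] by blast
    have kc: "k \<cdot> p \<in> carrier (Hom \<C> S B)" "k' \<cdot> q \<in> carrier (Hom \<C> S B)"
      using k c cmp_closed by blast+
    have "y \<cdot> ((k \<cdot> p) \<otimes>\<^bsub>Hom \<C> S B\<^esub> (k' \<cdot> q)) = h"
      using cmp_add_right[OF kc TD(2)] cmp_assoc[OF c(3) k(1) TD(2)] cmp_assoc[OF c(4) k(3) TD(2)]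
        k(2,4) from_biproduct_decompose[OF bp h] by simp
    then show "\<exists>k \<in> carrier (Hom \<C> S B). y \<cdot> k = h" using add_closed[OF kc] by blast
  }
qed

lemma Hom_to_exact_biproduct:
  assumes T: "(A, x, B, y, C, \<delta>) \<in> etriangles \<C>" and bp: "biproduct \<C> Y Y' S i j p q"
    and Y: "Hom_to_exact \<C> Y (A, x, B, y, C, \<delta>)" "Hom_to_exact \<C> Y' (A, x, B, y, C, \<delta>)"
  shows "Hom_to_exact \<C> S (A, x, B, y, C, \<delta>)"
  unfolding Hom_to_exact_iff[OF T]
proof (intro conjI ballI impI)
  note TD = etriangleD[OF T]
  have c: "i \<in> carrier (Hom \<C> Y S)" "j \<in> carrier (Hom \<C> Y' S)"
      "p \<in> carrier (Hom \<C> S Y)" "q \<in> carrier (Hom \<C> S Y')"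
    using bp by (auto simp: biproduct_def)
  {
    fix u assume u: "u \<in> carrier (Hom \<C> C S)" "u \<cdot> y = \<one>\<^bsub>Hom \<C> B S\<^esub>"
    have "(p \<cdot> u) \<cdot> y = \<one>\<^bsub>Hom \<C> B Y\<^esub>" "(q \<cdot> u) \<cdot> y = \<one>\<^bsub>Hom \<C> B Y'\<^esub>"
      using cmp_assoc[OF TD(2) u(1) c(3)] cmp_assoc[OF TD(2) u(1) c(4)] u(2)
        cmp_zero[OF c(3)] cmp_zero[OF c(4)] by auto
    then have "p \<cdot> u = \<one>\<^bsub>Hom \<C> C Y\<^esub>" "q \<cdot> u = \<one>\<^bsub>Hom \<C> C Y'\<^esub>"
      using Y cmp_closed[OF u(1) c(3)] cmp_closed[OF u(1) c(4)]
      unfolding Hom_to_exact_iff[OF T] by blast+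
    then show "u = \<one>\<^bsub>Hom \<C> C S\<^esub>"
      using to_biproduct_decompose[OF bp u(1)] cmp_zero[OF c(1)] cmp_zero[OF c(2)] zero_add_zero
      by simp
  next
    fix h assume h: "h \<in> carrier (Hom \<C> A S)"
    obtain k k' where k: "k \<in> carrier (Hom \<C> B Y)" "k \<cdot> x = p \<cdot> h"
      "k' \<in> carrier (Hom \<C> B Y')" "k' \<cdot> x = q \<cdot> h"
      using Y cmp_closed[OF h c(3)] cmp_closed[OF h c(4)]
      unfolding Hom_to_exact_iff[OF T] by blast
    have kc: "i \<cdot> k \<in> carrier (Hom \<C> B S)" "j \<cdot> k' \<in> carrier (Hom \<C> B S)"
      using k c cmp_closed by blast+
    have "((i \<cdot> k) \<otimes>\<^bsub>Hom \<C> B S\<^esub> (j \<cdot> k')) \<cdot> x = h"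
      using cmp_add_left[OF TD(1) kc] cmp_assoc[OF TD(1) k(1) c(1)] cmp_assoc[OF TD(1) k(3) c(2)]
        k(2,4) to_biproduct_decompose[OF bp h] by simp
    then show "\<exists>k \<in> carrier (Hom \<C> B S). k \<cdot> x = h" using add_closed[OF kc] by blast
  }
qed

lemma Hom_from_exact_summand:
  assumes T: "(A, x, B, y, C, \<delta>) \<in> etriangles \<C>" and bp: "biproduct \<C> X X' S i j p q"
    and S: "Hom_from_exact \<C> S (A, x, B, y, C, \<delta>)"
  shows "Hom_from_exact \<C> X (A, x, B, y, C, \<delta>)"
  unfolding Hom_from_exact_iff[OF T]
proof (intro conjI ballI impI)
  note TD = etriangleD[OF T]
  have c: "i \<in> carrier (Hom \<C> X S)" "p \<in> carrier (Hom \<C> S X)" and e: "p \<cdot> i = ide \<C> X"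
    using bp by (auto simp: biproduct_def)
  {
    fix u assume u: "u \<in> carrier (Hom \<C> X A)" "x \<cdot> u = \<one>\<^bsub>Hom \<C> X B\<^esub>"
    have "x \<cdot> (u \<cdot> p) = \<one>\<^bsub>Hom \<C> S B\<^esub>"
      using cmp_assoc[OF c(2) u(1) TD(1)] u(2) zero_cmp[OF c(2)] by simp
    then have "u \<cdot> p = \<one>\<^bsub>Hom \<C> S A\<^esub>"
      using S cmp_closed[OF c(2) u(1)] unfolding Hom_from_exact_iff[OF T] by blast
    then show "u = \<one>\<^bsub>Hom \<C> X A\<^esub>"
      using cmp_assoc[OF c u(1)] e zero_cmp[OF c(1)] ide_right[OF u(1)] by simp
  next
    fix h assume h: "h \<in> carrier (Hom \<C> X C)"
    obtain k where k: "k \<in> carrier (Hom \<C> S B)" "y \<cdot> k = h \<cdot> p"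
      using S cmp_closed[OF c(2) h] unfolding Hom_from_exact_iff[OF T] by blast
    have "y \<cdot> (k \<cdot> i) = h"
      using cmp_assoc[OF c(1) k(1) TD(2)] cmp_assoc[OF c h] k(2) e ide_right[OF h] by simp
    then show "\<exists>k \<in> carrier (Hom \<C> X B). y \<cdot> k = h" using cmp_closed[OF c(1) k(1)] by blast
  }
qed

lemma Hom_to_exact_summand:
  assumes T: "(A, x, B, y, C, \<delta>) \<in> etriangles \<C>" and bp: "biproduct \<C> Y Y' S i j p q"
    and S: "Hom_to_exact \<C> S (A, x, B, y, C, \<delta>)"
  shows "Hom_to_exact \<C> Y (A, x, B, y, C, \<delta>)"
  unfolding Hom_to_exact_iff[OF T]
proof (intro conjI ballI impI)
  note TD = etriangleD[OF T]
  have c: "i \<in> carrier (Hom \<C> Y S)" "p \<in> carrier (Hom \<C> S Y)" and e: "p \<cdot> i = ide \<C> Y"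
    using bp by (auto simp: biproduct_def)
  {
    fix u assume u: "u \<in> carrier (Hom \<C> C Y)" "u \<cdot> y = \<one>\<^bsub>Hom \<C> B Y\<^esub>"
    have "(i \<cdot> u) \<cdot> y = \<one>\<^bsub>Hom \<C> B S\<^esub>"
      using cmp_assoc[OF TD(2) u(1) c(1)] u(2) cmp_zero[OF c(1)] by simp
    then have "i \<cdot> u = \<one>\<^bsub>Hom \<C> C S\<^esub>"
      using S cmp_closed[OF u(1) c(1)] unfolding Hom_to_exact_iff[OF T] by blast
    then show "u = \<one>\<^bsub>Hom \<C> C Y\<^esub>"
      using cmp_assoc[OF u(1) c] e cmp_zero[OF c(2)] ide_left[OF u(1)] by simp
  next
    fix h assume h: "h \<in> carrier (Hom \<C> A Y)"
    obtain k where k: "k \<in> carrier (Hom \<C> B S)" "k \<cdot> x = i \<cdot> h"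
      using S cmp_closed[OF h c(1)] unfolding Hom_to_exact_iff[OF T] by blast
    have "(p \<cdot> k) \<cdot> x = h"
      using cmp_assoc[OF TD(1) k(1) c(2)] cmp_assoc[OF h c] k(2) e ide_left[OF h] by simp
    then show "\<exists>k \<in> carrier (Hom \<C> B Y). k \<cdot> x = h" using cmp_closed[OF k(1) c(2)] by blast
  }
qed

lemma projectives_additive:
  assumes "\<xi> \<subseteq> etriangles \<C>"
  shows "additive_subcategory \<C> (projectives \<C> \<xi>)" "summand_closed \<C> (projectives \<C> \<xi>)"
proof -
  show "additive_subcategory \<C> (projectives \<C> \<xi>)"
    unfolding additive_subcategory_def
  proof (intro conjI ballI)
    show "\<exists>Z \<in> projectives \<C> \<xi>. zero_object \<C> Z"
      using zero_object_exists Hom_from_exact_zero_object assms unfolding projectives_def by fast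
    fix X X' assume X: "X \<in> projectives \<C> \<xi>" "X' \<in> projectives \<C> \<xi>"
    obtain S i j p q where bp: "biproduct \<C> X X' S i j p q" using biproduct_exists by blast
    then have "S \<in> projectives \<C> \<xi>"
      using X Hom_from_exact_biproduct[OF _ bp] assms unfolding projectives_def by fast
    then show "\<exists>S \<in> projectives \<C> \<xi>. \<exists>i j p q. biproduct \<C> X X' S i j p q" using bp by blast
  qed
  show "summand_closed \<C> (projectives \<C> \<xi>)"
    using Hom_from_exact_summand assms unfolding summand_closed_def projectives_def by fast
qed

lemma injectives_additive:
  assumes "\<xi> \<subseteq> etriangles \<C>"
  shows "additive_subcategory \<C> (injectives \<C> \<xi>)" "summand_closed \<C> (injectives \<C> \<xi>)"
proof -
  show "additive_subcategory \<C> (injectives \<C> \<xi>)"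
    unfolding additive_subcategory_def
  proof (intro conjI ballI)
    show "\<exists>Z \<in> injectives \<C> \<xi>. zero_object \<C> Z"
      using zero_object_exists Hom_to_exact_zero_object assms unfolding injectives_def by fast
    fix Y Y' assume Y: "Y \<in> injectives \<C> \<xi>" "Y' \<in> injectives \<C> \<xi>"
    obtain S i j p q where bp: "biproduct \<C> Y Y' S i j p q" using biproduct_exists by blast
    then have "S \<in> injectives \<C> \<xi>"
      using Y Hom_to_exact_biproduct[OF _ bp] assms unfolding injectives_def by fast
    then show "\<exists>S \<in> injectives \<C> \<xi>. \<exists>i j p q. biproduct \<C> Y Y' S i j p q" using bp by blast
  qed
  show "summand_closed \<C> (injectives \<C> \<xi>)"
    using Hom_to_exact_summand assms unfolding summand_closed_def injectives_def by fast
qed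

theorem balanced_pair_of_proper_class:
  assumes "proper_class \<C> \<xi>" "enough_projectives \<C> \<xi>" "enough_injectives \<C> \<xi>"
  shows "balanced_pair \<C> (projectives \<C> \<xi>) (injectives \<C> \<xi>)"
    and "xi_lower \<C> (projectives \<C> \<xi>) = \<xi>"
proof -
  have s: "\<xi> \<subseteq> etriangles \<C>" and cl: "base_change_closed \<C> \<xi>" "cobase_change_closed \<C> \<xi>"
    using assms(1) by (auto simp: proper_class_def)
  show low: "xi_lower \<C> (projectives \<C> \<xi>) = \<xi>"
    using xi_lower_projectives cl s assms by blast
  have up: "xi_upper \<C> (injectives \<C> \<xi>) = \<xi>"
    using xi_upper_injectives cl s assms by blast
  show "balanced_pair \<C> (projectives \<C> \<xi>) (injectives \<C> \<xi>)"
    unfolding balanced_pair_def low up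
    using projectives_additive[OF s] injectives_additive[OF s] assms by blast
qed


section \<open>The class of a balanced pair is proper\<close>

text \<open>
  With \<open>y' b = y\<close> for the old deflation \<open>y\<close> and the new one \<open>y'\<close>, a map killed by \<open>y'\<close> is killed
  by \<open>y\<close>; and \<open>h : A' \<rightarrow> Y\<close> extends because \<open>h\<^sub>* a\<^sub>* \<delta> = (h a)\<^sub>* \<delta> = 0\<close>.
\<close>

lemma xi_upper_cobase_change_closed: "cobase_change_closed \<C> (xi_upper \<C> \<Y>)"
  unfolding cobase_change_closed_def
proof (intro allI impI, elim conjE)
  fix A x B y C \<delta> A' a x' B' y'
  assume T: "(A, x, B, y, C, \<delta>) \<in> xi_upper \<C> \<Y>" and a: "a \<in> carrier (Hom \<C> A A')"
    and T': "(A', x', B', y', C, push \<C> a \<delta>) \<in> etriangles \<C>"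
  have Te: "(A, x, B, y, C, \<delta>) \<in> etriangles \<C>" using T by (simp add: xi_upper_def)
  note TD = etriangleD[OF Te] and TD' = etriangleD[OF T']
  have "push \<C> a \<delta> = pull \<C> (ide \<C> C) (push \<C> a \<delta>)" using TD'(3) by (simp add: pl_ide)
  then obtain b where b: "b \<in> carrier (Hom \<C> B B')" "y' \<cdot> b = ide \<C> C \<cdot> y"
    using rlz_morphism[OF Te T' a ide_closed] by blast
  have y: "y' \<cdot> b = y" using b(2) TD(2) by (simp add: ide_left)
  have "Hom_to_exact \<C> Y (A', x', B', y', C, push \<C> a \<delta>)" if "Y \<in> \<Y>" for Y
    unfolding Hom_to_exact_iff[OF T']
  proof (intro conjI ballI impI)
    have ex: "Hom_to_exact \<C> Y (A, x, B, y, C, \<delta>)" using T that by (simp add: xi_upper_def)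
    {
      fix u assume u: "u \<in> carrier (Hom \<C> C Y)" "u \<cdot> y' = \<one>\<^bsub>Hom \<C> B' Y\<^esub>"
      have "u \<cdot> y = \<one>\<^bsub>Hom \<C> B Y\<^esub>"
        using cmp_assoc[OF b(1) TD'(2) u(1)] u(2) y zero_cmp[OF b(1)] by simp
      then show "u = \<one>\<^bsub>Hom \<C> C Y\<^esub>" using ex u(1) unfolding Hom_to_exact_iff[OF Te] by blast
    next
      fix h assume h: "h \<in> carrier (Hom \<C> A' Y)"
      have ha: "h \<cdot> a \<in> carrier (Hom \<C> A Y)" using a h cmp_closed by blast
      then have "push \<C> (h \<cdot> a) \<delta> = \<one>\<^bsub>Ext \<C> C Y\<^esub>"
        using ex extends_iff_push_zero[OF Te ha] unfolding Hom_to_exact_iff[OF Te] by blast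
      then have "push \<C> h (push \<C> a \<delta>) = \<one>\<^bsub>Ext \<C> C Y\<^esub>" using pu_cmp[OF TD(3) a h] by simp
      then show "\<exists>k \<in> carrier (Hom \<C> B' Y). k \<cdot> x' = h"
        using extends_iff_push_zero[OF T' h] by blast
    }
  qed
  then show "(A', x', B', y', C, push \<C> a \<delta>) \<in> xi_upper \<C> \<Y>" using T' by (simp add: xi_upper_def)
qed

text \<open>
  Injectivity of \<open>\<C>(X, A) \<rightarrow> \<C>(X, B)\<close> is automatic once the extension vanishes on \<open>\<X>\<close>: the triangle
  is then a cobase change of a projective presentation of its end term.  Membership thus becomes a
  condition on the extension alone.
\<close>

lemma mem_xi_lower_iff:
  assumes cl: "cobase_change_closed \<C> (xi_lower \<C> \<X>)"
    and enough: "enough_projectives \<C> (xi_lower \<C> \<X>)" and \<X>: "\<X> = projectives \<C> (xi_lower \<C> \<X>)"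
  shows "(A, x, B, y, C, \<delta>) \<in> xi_lower \<C> \<X> \<longleftrightarrow> (A, x, B, y, C, \<delta>) \<in> etriangles \<C> \<and>
    (\<forall>X \<in> \<X>. \<forall>h \<in> carrier (Hom \<C> X C). pull \<C> h \<delta> = \<one>\<^bsub>Ext \<C> X A\<^esub>)"
proof (intro iffI conjI; (elim conjE)?)
  assume T: "(A, x, B, y, C, \<delta>) \<in> xi_lower \<C> \<X>"
  then show Te: "(A, x, B, y, C, \<delta>) \<in> etriangles \<C>" by (simp add: xi_lower_def)
  show "\<forall>X \<in> \<X>. \<forall>h \<in> carrier (Hom \<C> X C). pull \<C> h \<delta> = \<one>\<^bsub>Ext \<C> X A\<^esub>"
    using T Hom_from_exact_iff[OF Te] lifts_iff_pull_zero[OF Te] unfolding xi_lower_def by blast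
next
  assume Te: "(A, x, B, y, C, \<delta>) \<in> etriangles \<C>"
    and z: "\<forall>X \<in> \<X>. \<forall>h \<in> carrier (Hom \<C> X C). pull \<C> h \<delta> = \<one>\<^bsub>Ext \<C> X A\<^esub>"
  have s: "xi_lower \<C> \<X> \<subseteq> etriangles \<C>" by (auto simp: xi_lower_def)
  obtain K w P p \<kappa> where K: "(K, w, P, p, C, \<kappa>) \<in> xi_lower \<C> \<X>" and P: "P \<in> \<X>"
    using enough \<X> unfolding enough_projectives_def by metis
  have p: "p \<in> carrier (Hom \<C> P C)" using K s etriangleD by blast
  obtain b where "b \<in> carrier (Hom \<C> P B)" "y \<cdot> b = p"
    using lifts_iff_pull_zero[OF Te p] z P p by blast
  then show "(A, x, B, y, C, \<delta>) \<in> xi_lower \<C> \<X>" using mem_if_deflation_lifts[OF cl s K Te] by blast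
qed

theorem proper_class_of_balanced_pair:
  assumes bal: "balanced_pair \<C> \<X> \<Y>"
  shows "proper_class \<C> (xi_lower \<C> \<X>)"
proof -
  let ?\<xi> = "xi_lower \<C> \<X>"
  have cobase: "cobase_change_closed \<C> ?\<xi>"
    using bal xi_upper_cobase_change_closed[of \<Y>] by (simp add: balanced_pair_def)
  have mem: "(A, x, B, y, C, \<delta>) \<in> ?\<xi> \<longleftrightarrow> (A, x, B, y, C, \<delta>) \<in> etriangles \<C> \<and>
      (\<forall>X \<in> \<X>. \<forall>h \<in> carrier (Hom \<C> X C). pull \<C> h \<delta> = \<one>\<^bsub>Ext \<C> X A\<^esub>)" for A x B y C \<delta>
    using mem_xi_lower_iff[OF cobase] bal unfolding balanced_pair_def by blast
  have "iso_closed \<C> ?\<xi>"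
    unfolding iso_closed_def
  proof (intro ballI impI)
    fix T T' assume T: "T \<in> ?\<xi>" and T': "T' \<in> etriangles \<C>" and iso: "tri_iso \<C> T T'"
    obtain A x B y C \<delta> A' x' B' y' C' \<delta>' a c where
      eq: "T = (A, x, B, y, C, \<delta>)" "T' = (A', x', B', y', C', \<delta>')"
      and a: "a \<in> carrier (Hom \<C> A A')" and ci: "is_iso \<C> C C' c"
      and ac: "push \<C> a \<delta> = pull \<C> c \<delta>'"
      using iso unfolding tri_iso_def is_iso_def by blast
    obtain d where c: "c \<in> carrier (Hom \<C> C C')" and d: "d \<in> carrier (Hom \<C> C' C)" "c \<cdot> d = ide \<C> C'"
      using ci unfolding is_iso_def by blast
    note TD' = etriangleD[OF T'[unfolded eq]]
    have \<delta>: "\<delta> \<in> carrier (Ext \<C> C A)" using T mem etriangleD(3) unfolding eq by blast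
    have "pull \<C> h \<delta>' = \<one>\<^bsub>Ext \<C> X A'\<^esub>" if X: "X \<in> \<X>" and h: "h \<in> carrier (Hom \<C> X C')" for X h
    proof -
      have dh: "d \<cdot> h \<in> carrier (Hom \<C> X C)" using d(1) h cmp_closed by blast
      have "h = c \<cdot> (d \<cdot> h)" using cmp_assoc[OF h d(1) c] d(2) ide_left[OF h] by simp
      then have "pull \<C> h \<delta>' = pull \<C> (d \<cdot> h) (push \<C> a \<delta>)"
        using pl_cmp[OF TD'(3) c dh] ac by simp
      also have "\<dots> = push \<C> a (pull \<C> (d \<cdot> h) \<delta>)" using pu_pl[OF \<delta> a dh] by simp
      also have "\<dots> = \<one>\<^bsub>Ext \<C> X A'\<^esub>" using T X dh push_zero[OF a] unfolding eq mem by simp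
      finally show ?thesis .
    qed
    then show "T' \<in> ?\<xi>" using T' unfolding eq mem by blast
  qed
  moreover have "coproduct_closed \<C> ?\<xi>"
    unfolding coproduct_closed_def
  proof (intro ballI allI impI)
    fix T T' T'' assume T: "T \<in> ?\<xi>" "T' \<in> ?\<xi>" and sum: "tri_direct_sum \<C> T T' T''"
    have Te: "T \<in> etriangles \<C>" "T' \<in> etriangles \<C>" using T by (auto simp: xi_lower_def)
    have T'': "T'' \<in> etriangles \<C>" using rlz_sum[OF Te sum] .
    obtain A x B y C \<delta> A' x' B' y' C' \<delta>' SA iA jA pA qA SB iB jB pB qB SC iC jC pC qC where
      eq: "T = (A, x, B, y, C, \<delta>)" "T' = (A', x', B', y', C', \<delta>')"
        "T'' = (SA, (iB \<cdot> x \<cdot> pA) \<otimes>\<^bsub>Hom \<C> SA SB\<^esub> (jB \<cdot> x' \<cdot> qA),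
          SB, (iC \<cdot> y \<cdot> pB) \<otimes>\<^bsub>Hom \<C> SB SC\<^esub> (jC \<cdot> y' \<cdot> qB),
          SC, push \<C> iA (pull \<C> pC \<delta>) \<otimes>\<^bsub>Ext \<C> SC SA\<^esub> push \<C> jA (pull \<C> qC \<delta>'))"
      and bp: "biproduct \<C> A A' SA iA jA pA qA" "biproduct \<C> C C' SC iC jC pC qC"
      using sum unfolding tri_direct_sum_def by (elim exE conjE) (rule that)
    have c: "iA \<in> carrier (Hom \<C> A SA)" "jA \<in> carrier (Hom \<C> A' SA)"
        "pC \<in> carrier (Hom \<C> SC C)" "qC \<in> carrier (Hom \<C> SC C')"
      using bp by (auto simp: biproduct_def)
    have \<delta>: "\<delta> \<in> carrier (Ext \<C> C A)" "\<delta>' \<in> carrier (Ext \<C> C' A')"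
      using etriangleD(3) Te unfolding eq by blast+
    have vanish: "pull \<C> h (push \<C> i (pull \<C> p \<epsilon>)) = \<one>\<^bsub>Ext \<C> X SA\<^esub>"
      if "(D, u, E, v, F, \<epsilon>) \<in> ?\<xi>" "X \<in> \<X>" and h: "h \<in> carrier (Hom \<C> X SC)"
        and i: "i \<in> carrier (Hom \<C> D SA)" and p: "p \<in> carrier (Hom \<C> SC F)" for D u E v F \<epsilon> X h i p
    proof -
      have \<epsilon>: "\<epsilon> \<in> carrier (Ext \<C> F D)" using that(1) mem etriangleD(3) by blast
      have "pull \<C> h (push \<C> i (pull \<C> p \<epsilon>)) = push \<C> i (pull \<C> (p \<cdot> h) \<epsilon>)"
        using pu_pl[OF pull_closed[OF \<epsilon> p] i h] pl_cmp[OF \<epsilon> p h] by simp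
      moreover have "pull \<C> (p \<cdot> h) \<epsilon> = \<one>\<^bsub>Ext \<C> X D\<^esub>"
        using that cmp_closed[OF h p] mem by blast
      ultimately show ?thesis using push_zero[OF i] by simp
    qed
    have "pull \<C> h (push \<C> iA (pull \<C> pC \<delta>) \<otimes>\<^bsub>Ext \<C> SC SA\<^esub> push \<C> jA (pull \<C> qC \<delta>')) = \<one>\<^bsub>Ext \<C> X SA\<^esub>"
      if X: "X \<in> \<X>" and h: "h \<in> carrier (Hom \<C> X SC)" for X h
    proof -
      have "push \<C> iA (pull \<C> pC \<delta>) \<in> carrier (Ext \<C> SC SA)"
          "push \<C> jA (pull \<C> qC \<delta>') \<in> carrier (Ext \<C> SC SA)"
        using \<delta> c by (auto intro!: push_closed pull_closed)
      then show ?thesis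
        using hom_mult[OF pl_hom[OF h]] vanish[OF T(1)[unfolded eq] X h c(1,3)]
          vanish[OF T(2)[unfolded eq] X h c(2,4)]
          monoid.l_one[OF group.is_monoid[OF group_Ext] Ext_zero_closed]
        by simp
    qed
    then show "T'' \<in> ?\<xi>" using T'' unfolding eq mem by blast
  qed
  moreover have "split_triangles \<C> \<subseteq> ?\<xi>"
    using mem pull_zero by (auto simp: split_triangles_def)
  moreover have "base_change_closed \<C> ?\<xi>"
    unfolding base_change_closed_def
  proof (intro allI impI, elim conjE)
    fix A x B y C \<delta> C' c x' B' y'
    assume T: "(A, x, B, y, C, \<delta>) \<in> ?\<xi>" and c: "c \<in> carrier (Hom \<C> C' C)"
      and T': "(A, x', B', y', C', pull \<C> c \<delta>) \<in> etriangles \<C>"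
    have \<delta>: "\<delta> \<in> carrier (Ext \<C> C A)" using T mem etriangleD(3) by blast
    have "pull \<C> h (pull \<C> c \<delta>) = \<one>\<^bsub>Ext \<C> X A\<^esub>"
      if "X \<in> \<X>" "h \<in> carrier (Hom \<C> X C')" for X h
      using that T mem cmp_closed[OF that(2) c] pl_cmp[OF \<delta> c that(2)] by metis
    then show "(A, x', B', y', C', pull \<C> c \<delta>) \<in> ?\<xi>" using T' mem by blast
  qed
  moreover have "saturated \<C> ?\<xi>"
    unfolding saturated_def
  proof (intro allI impI, elim conjE)
    fix A1 x1 B1 y1 C \<delta>1 A2 x2 B2 y2 \<delta>2 m M e
    assume T1: "(A1, x1, B1, y1, C, \<delta>1) \<in> etriangles \<C>"
      and T2: "(A2, x2, B2, y2, C, \<delta>2) \<in> ?\<xi>"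
      and T3: "(A1, m, M, e, B2, pull \<C> y2 \<delta>1) \<in> ?\<xi>"
    have T2e: "(A2, x2, B2, y2, C, \<delta>2) \<in> etriangles \<C>" using T2 mem by blast
    have "pull \<C> h \<delta>1 = \<one>\<^bsub>Ext \<C> X A1\<^esub>" if X: "X \<in> \<X>" and h: "h \<in> carrier (Hom \<C> X C)" for X h
    proof -
      \<comment> \<open>Lift \<open>h\<close> to \<open>B2\<close>, where the extension is already known to vanish on \<open>X\<close>.\<close>
      obtain k where k: "k \<in> carrier (Hom \<C> X B2)" "y2 \<cdot> k = h"
        using lifts_iff_pull_zero[OF T2e h] T2 mem X h by blast
      have "pull \<C> h \<delta>1 = pull \<C> k (pull \<C> y2 \<delta>1)"
        using pl_cmp[OF etriangleD(3)[OF T1] etriangleD(2)[OF T2e] k(1)] k(2) by simp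
      also have "\<dots> = \<one>\<^bsub>Ext \<C> X A1\<^esub>" using T3 mem X k(1) by blast
      finally show ?thesis .
    qed
    then show "(A1, x1, B1, y1, C, \<delta>1) \<in> ?\<xi>" using T1 mem by blast
  qed
  ultimately show ?thesis
    using cobase unfolding proper_class_def by (auto simp: xi_lower_def)
qed

end


section \<open>The bijection\<close>

theorem theorem3p10:
  fixes \<C> :: "('o, 'm, 'e, 'n) neg_ext_precat"
  assumes "neg_extriangulated \<C>"
  shows "(\<forall>(\<X>, \<Y>) \<in> balanced_pairs \<C>.
            Psi \<C> (\<X>, \<Y>) = xi_lower \<C> \<X> \<and> Psi \<C> (\<X>, \<Y>) = xi_upper \<C> \<Y>) \<and>
         bij_betw (Psi \<C>) (balanced_pairs \<C>) (proper_classes_enough \<C>) \<and>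
         bij_betw (Phi \<C>) (proper_classes_enough \<C>) (balanced_pairs \<C>) \<and>
         (\<forall>p \<in> balanced_pairs \<C>. Phi \<C> (Psi \<C> p) = p) \<and>
         (\<forall>\<xi> \<in> proper_classes_enough \<C>. Psi \<C> (Phi \<C> \<xi>) = \<xi>)"
proof -
  interpret neg_extriangulated \<C> by fact
  have up: "\<forall>(\<X>, \<Y>) \<in> balanced_pairs \<C>.
      Psi \<C> (\<X>, \<Y>) = xi_lower \<C> \<X> \<and> Psi \<C> (\<X>, \<Y>) = xi_upper \<C> \<Y>"
    by (auto simp: balanced_pairs_def balanced_pair_def Psi_def)
  have PhiPsi: "\<forall>p \<in> balanced_pairs \<C>. Phi \<C> (Psi \<C> p) = p"
    by (auto simp: balanced_pairs_def balanced_pair_def Psi_def Phi_def)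
  have PsiPhi: "\<forall>\<xi> \<in> proper_classes_enough \<C>. Psi \<C> (Phi \<C> \<xi>) = \<xi>"
    using balanced_pair_of_proper_class(2)
    by (auto simp: proper_classes_enough_def Psi_def Phi_def)
  have Psi: "Psi \<C> ` balanced_pairs \<C> \<subseteq> proper_classes_enough \<C>"
  proof (clarsimp simp: balanced_pairs_def Psi_def proper_classes_enough_def)
    fix \<X> \<Y> assume bal: "balanced_pair \<C> \<X> \<Y>"
    then have "xi_lower \<C> \<X> = xi_upper \<C> \<Y>" "enough_projectives \<C> (xi_lower \<C> \<X>)"
        "enough_injectives \<C> (xi_upper \<C> \<Y>)"
      unfolding balanced_pair_def by blast+
    then show "proper_class \<C> (xi_lower \<C> \<X>) \<and> enough_projectives \<C> (xi_lower \<C> \<X>) \<and>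
        enough_injectives \<C> (xi_lower \<C> \<X>)"
      using proper_class_of_balanced_pair[OF bal] by simp
  qed
  have Phi: "Phi \<C> ` proper_classes_enough \<C> \<subseteq> balanced_pairs \<C>"
    using balanced_pair_of_proper_class(1)
    by (auto simp: proper_classes_enough_def balanced_pairs_def Phi_def)
  show ?thesis
    using up PhiPsi PsiPhi bij_betw_byWitness[OF PhiPsi PsiPhi Psi Phi]
      bij_betw_byWitness[OF PsiPhi PhiPsi Phi Psi] by blast
qed

end
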